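(* Let $1<p<+\infty$ and $g\in\mathcal{B}$. The following are equivalent: (1) $T_g(RM(p,\infty))\subset RM(p,0)$. (2) $T_g:RM(p,0)\rightarrow RM(p,0)$ is weakly compact. (3) $T_g:RM(p,\infty)\rightarrow RM(p,\infty)$ is weakly compact.
   Context: $\mathbb{D}$ is the open unit disc of $\mathbb{C}$ and $\mathcal{H}(\mathbb{D})$ the space of analytic functions on $\mathbb{D}$. For $1\le p<+\infty$, $RM(p,\infty)=\{f\in\mathcal{H}(\mathbb{D}):\rho_{p,\infty}(f)<+\infty\}$, a Banach space with norm $\rho_{p,\infty}(f)=\operatorname{ess\,sup}_{t\in[0,2\pi)}\big(\int_0^1|f(re^{it})|^p\,dr\big)^{1/p}$. $RM(p,0)$ is the closed subspace of $RM(p,\infty)$ (with the same norm) consisting of the $f\in\mathcal{H}(\mathbb{D})$ with $\lim_{\rho\to1}\sup_\theta\big(\int_\rho^1|f(re^{i\theta})|^p\,dr\big)^{1/p}=0$. The Bloch space $\mathcal{B}$ is the set of $f\in\mathcal{H}(\mathbb{D})$ with $\sup_{z\in\mathbb{D}}(1-|z|^2)|f'(z)|<+\infty$. The integration operator is $T_g(f)(z)=\int_0^z f(w)g'(w)\,dw$, $z\in\mathbb{D}$; for $g\in\mathcal{B}$ it is bounded on $RM(p,\infty)$ and on $RM(p,0)$. *)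

theory Defs
  imports "HOL-Probability.Essential_Supremum" "HOL-Complex_Analysis.Complex_Analysis"
begin

section \<open>Weak topology and weakly compact operators\<close>

text \<open>
  Normed spaces are given by a carrier \<open>V\<close> of complex-valued functions with the pointwise
  operations and a norm \<open>N\<close>. Functionals and operators are total functions of which
  only the values on the carrier matter.
\<close>

definition clinear_on ::
  "('a \<Rightarrow> complex) set \<Rightarrow> (('a \<Rightarrow> complex) \<Rightarrow> ('b \<Rightarrow> complex)) \<Rightarrow> bool" where
  "clinear_on V T \<longleftrightarrow>
     (\<forall>x\<in>V. \<forall>y\<in>V. T (\<lambda>z. x z + y z) = (\<lambda>w. T x w + T y w)) \<and>
     (\<forall>c. \<forall>x\<in>V. T (\<lambda>z. c * x z) = (\<lambda>w. c * T x w))"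

definition bounded_functionals ::
  "('a \<Rightarrow> complex) set \<Rightarrow> (('a \<Rightarrow> complex) \<Rightarrow> real) \<Rightarrow> (('a \<Rightarrow> complex) \<Rightarrow> complex) set" where
  "bounded_functionals V N = {\<phi>.
     (\<forall>x\<in>V. \<forall>y\<in>V. \<phi> (\<lambda>z. x z + y z) = \<phi> x + \<phi> y) \<and>
     (\<forall>c. \<forall>x\<in>V. \<phi> (\<lambda>z. c * x z) = c * \<phi> x) \<and>
     (\<exists>C. \<forall>x\<in>V. cmod (\<phi> x) \<le> C * N x)}"

text \<open>The zero functional makes \<open>V\<close> the whole space of this topology.\<close>

definition weak_topology ::
  "('a \<Rightarrow> complex) set \<Rightarrow> (('a \<Rightarrow> complex) \<Rightarrow> real) \<Rightarrow> ('a \<Rightarrow> complex) topology" where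
  "weak_topology V N =
     topology_generated_by {{x \<in> V. \<phi> x \<in> U} | \<phi> U. \<phi> \<in> bounded_functionals V N \<and> open U}"

definition bounded_operator ::
  "('a \<Rightarrow> complex) set \<Rightarrow> (('a \<Rightarrow> complex) \<Rightarrow> real) \<Rightarrow>
   ('b \<Rightarrow> complex) set \<Rightarrow> (('b \<Rightarrow> complex) \<Rightarrow> real) \<Rightarrow>
   (('a \<Rightarrow> complex) \<Rightarrow> ('b \<Rightarrow> complex)) \<Rightarrow> bool" where
  "bounded_operator V N W M T \<longleftrightarrow>
     T ` V \<subseteq> W \<and> clinear_on V T \<and> (\<exists>C. \<forall>x\<in>V. M (T x) \<le> C * N x)"

definition weakly_compact_operator ::
  "('a \<Rightarrow> complex) set \<Rightarrow> (('a \<Rightarrow> complex) \<Rightarrow> real) \<Rightarrow>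
   ('b \<Rightarrow> complex) set \<Rightarrow> (('b \<Rightarrow> complex) \<Rightarrow> real) \<Rightarrow>
   (('a \<Rightarrow> complex) \<Rightarrow> ('b \<Rightarrow> complex)) \<Rightarrow> bool" where
  "weakly_compact_operator V N W M T \<longleftrightarrow>
     bounded_operator V N W M T \<and>
     compactin (weak_topology W M) (weak_topology W M closure_of (T ` {x \<in> V. N x \<le> 1}))"


section \<open>Spaces of average radial integrability\<close>

text \<open>
  An analytic function on the disc is represented by its extension by zero, so that
  equality in HOL is equality on the disc.
\<close>

definition analytic_disc :: "(complex \<Rightarrow> complex) set" where
  "analytic_disc = {f. f holomorphic_on ball 0 1 \<and> (\<forall>z. z \<notin> ball 0 1 \<longrightarrow> f z = 0)}"

definition ennpowr :: "ennreal \<Rightarrow> real \<Rightarrow> ennreal" where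
  "ennpowr x a = (if x = top then top else ennreal (enn2real x powr a))"

definition radial_norm :: "real \<Rightarrow> real \<Rightarrow> (complex \<Rightarrow> complex) \<Rightarrow> real \<Rightarrow> ennreal" where
  "radial_norm p s f t =
     ennpowr (\<integral>\<^sup>+ r\<in>{s..<1}. ennreal (cmod (f (rcis r t)) powr p) \<partial>lborel) (1 / p)"

definition rho_inf :: "real \<Rightarrow> (complex \<Rightarrow> complex) \<Rightarrow> ennreal" where
  "rho_inf p f = esssup (restrict_space lborel {0..<2 * pi}) (radial_norm p 0 f)"

definition RM_inf :: "real \<Rightarrow> (complex \<Rightarrow> complex) set" where
  "RM_inf p = {f \<in> analytic_disc. rho_inf p f < top}"

definition RM_norm :: "real \<Rightarrow> (complex \<Rightarrow> complex) \<Rightarrow> real" where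
  "RM_norm p f = enn2real (rho_inf p f)"

definition RM_zero :: "real \<Rightarrow> (complex \<Rightarrow> complex) set" where
  "RM_zero p = {f \<in> analytic_disc. ((\<lambda>s. SUP t. radial_norm p s f t) \<longlongrightarrow> 0) (at_left 1)}"

definition bloch :: "(complex \<Rightarrow> complex) set" where
  "bloch = {f \<in> analytic_disc. bdd_above ((\<lambda>z. (1 - (cmod z)\<^sup>2) * cmod (deriv f z)) ` ball 0 1)}"

definition integration_op :: "(complex \<Rightarrow> complex) \<Rightarrow> (complex \<Rightarrow> complex) \<Rightarrow> (complex \<Rightarrow> complex)" where
  "integration_op g f = (\<lambda>z. if z \<in> ball 0 1
     then contour_integral (linepath 0 z) (\<lambda>w. f w * deriv g w) else 0)"

end

theory Submission
  imports Defs
begin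

text \<open>
  All three statements are linked without duality theory. Write \<open>X\<close> for \<open>RM_zero p\<close>, \<open>Y\<close> for
  \<open>RM_inf p\<close> and \<open>T\<close> for the integration operator.

  Suppose that \<open>T\<close> maps \<open>Y\<close> into \<open>X\<close>. A bounded sequence in \<open>X\<close> that tends to 0 locally
  uniformly has subsequences of almost disjoint radial support; since \<open>p > 1\<close>, sums of \<open>N\<close> of them
  grow like \<open>N powr (1 / p)\<close>, so every bounded functional tends to 0 along the sequence. Hence \<open>T\<close>
  is continuous from the unit ball of \<open>Y\<close>, which is compact for locally uniform convergence by
  Montel's theorem, to \<open>X\<close> and to \<open>Y\<close> with their weak topologies.

  Conversely, suppose that \<open>T\<close> is weakly compact on \<open>X\<close> or on \<open>Y\<close>, and let \<open>f\<close> be in \<open>Y\<close>. The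
  dilations of \<open>f\<close> lie in \<open>X\<close> and their images have a weak cluster point, which evaluations identify
  as \<open>T f\<close>. This proves \<open>T f \<in> X\<close> in the first case. In the second case it shows that a functional
  vanishing on \<open>X\<close> vanishes at \<open>T f\<close>; but an element of \<open>Y\<close> outside \<open>X\<close> is detected by a cluster
  point of pairings with its own radial tails.
\<close>

section \<open>Radial integrals and the norm\<close>

text \<open>The weak topologies need not be metrizable: compactness yields cluster points, not
  convergent subsequences, and sequential continuity alone says nothing about compactness. Hence the
  ball of the larger space is first carried to a compact metrizable set, where sequences suffice. In
  the converse direction a cluster point is enough, because a functional whose values converge along
  the sequence takes that limit at every cluster point.

  Boundedness is part of the definition of a weakly compact operator and has to be proved. For
  \<open>g\<close> in the Bloch space the derivative of the image along a radius is at most a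
  constant times \<open>cmod f / (1 - r)\<close>, which is the situation of Hardy's inequality.

  \<open>radint\<close> is the \<open>p\<close>-th power of \<open>radial_norm\<close>: without the
  root, integrals over pieces of a radius add up. For analytic \<open>f\<close> it is lower
  semicontinuous in the angle, so the essential supremum in the norm amounts to a bound at every
  angle, and most estimates can be made on one radius at a time.\<close>

definition radint :: "real \<Rightarrow> (complex \<Rightarrow> complex) \<Rightarrow> real \<Rightarrow> real \<Rightarrow> ennreal" where
  "radint p f s t = (\<integral>\<^sup>+ r\<in>{s..<1}. ennreal (cmod (f (rcis r t)) powr p) \<partial>lborel)"

lemma radial_norm_radint: "radial_norm p s f t = ennpowr (radint p f s t) (1 / p)"
  by (simp add: radial_norm_def radint_def)

lemma ennpowr_inverse_le_iff:
  assumes "0 < p" "0 \<le> c"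
  shows "ennpowr x (1 / p) \<le> ennreal c \<longleftrightarrow> x \<le> ennreal (c powr p)"
proof (cases x)
  case (real r)
  have "r powr (1/p) \<le> c \<longleftrightarrow> r \<le> c powr p"
  proof
    assume "r powr (1/p) \<le> c"
    then have "(r powr (1/p)) powr p \<le> c powr p"
      using assms by (intro powr_mono2) auto
    then show "r \<le> c powr p" using assms real by (simp add: powr_powr)
  next
    assume "r \<le> c powr p"
    then have "r powr (1/p) \<le> (c powr p) powr (1/p)"
      using assms real by (intro powr_mono2) auto
    then show "r powr (1/p) \<le> c" using assms by (simp add: powr_powr)
  qed
  then show ?thesis using real assms by (simp add: ennpowr_def)
qed (auto simp: ennpowr_def top_unique)

lemma analytic_disc_holomorphic: "f \<in> analytic_disc \<Longrightarrow> f holomorphic_on ball 0 1"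
  by (simp add: analytic_disc_def)

lemma analytic_disc_continuous: "f \<in> analytic_disc \<Longrightarrow> continuous_on (ball 0 1) f"
  by (simp add: analytic_disc_def holomorphic_on_imp_continuous_on)

lemma analytic_disc_measurable [measurable_dest]:
  assumes "f \<in> analytic_disc"
  shows "f \<in> borel_measurable borel"
proof -
  have "(\<lambda>z. indicator (ball 0 1) z *\<^sub>R f z) \<in> borel_measurable borel"
    using analytic_disc_continuous[OF assms]
    by (intro borel_measurable_continuous_on_indicator) auto
  also have "(\<lambda>z. indicator (ball 0 1) z *\<^sub>R f z) = f"
    using assms by (auto simp: analytic_disc_def indicator_def)
  finally show ?thesis .
qed

lemma rcis_measurable [measurable]: "(\<lambda>x. rcis (fst x) (snd x)) \<in> borel_measurable (borel \<Otimes>\<^sub>M borel)"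
proof -
  have "continuous_on UNIV (\<lambda>x::real\<times>real. rcis (fst x) (snd x))"
    by (simp add: rcis_def cis_conv_exp) (intro continuous_intros)
  then show ?thesis
    by (metis borel_measurable_continuous_onI borel_prod)
qed

lemma rcis_measurable' [measurable (raw)]:
  assumes [measurable]: "g \<in> borel_measurable M" "h \<in> borel_measurable M"
  shows "(\<lambda>x. rcis (g x) (h x)) \<in> borel_measurable M"
  using measurable_compose[OF measurable_Pair[OF assms] rcis_measurable] by simp

lemma radial_measurable:
  assumes "f \<in> analytic_disc"
  shows "(\<lambda>r. f (rcis r t)) \<in> borel_measurable borel"
  using analytic_disc_measurable[OF assms] by measurable

lemma radint_mono: "s \<le> s' \<Longrightarrow> radint p f s' t \<le> radint p f s t"
  unfolding radint_def by (intro nn_integral_mono) (auto simp: indicator_def)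

lemma radint_periodic: "radint p f s (t + 2 * pi * of_int k) = radint p f s t"
proof -
  have "rcis r (t + 2 * pi * of_int k) = rcis r t" for r
    by (metis rcis_def cis_mult cis_multiple_2pi Ints_of_int mult.right_neutral)
  then show ?thesis by (simp add: radint_def)
qed

text \<open>Fatou's lemma in the form used throughout. It is applied to a varying angle, to
  truncations in Hardy's inequality and to locally uniform limits.\<close>

lemma nn_integral_powr_le_limit:
  fixes F :: "nat \<Rightarrow> real \<Rightarrow> complex"
  assumes "0 < p" and [measurable]: "\<And>n. F n \<in> borel_measurable borel"
    and lim: "\<And>r. r \<in> A \<Longrightarrow> (\<lambda>n. F n r) \<longlonglongrightarrow> F0 r"
    and [measurable]: "A \<in> sets borel"
    and le: "\<And>n. (\<integral>\<^sup>+ r\<in>A. ennreal (cmod (F n r) powr p) \<partial>lborel) \<le> b"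
  shows "(\<integral>\<^sup>+ r\<in>A. ennreal (cmod (F0 r) powr p) \<partial>lborel) \<le> b"
proof -
  have "(\<lambda>n. ennreal (cmod (F n r) powr p) * indicator A r)
          \<longlonglongrightarrow> ennreal (cmod (F0 r) powr p) * indicator A r" for r
  proof (cases "r \<in> A")
    case True
    then have "(\<lambda>n. ennreal (cmod (F n r) powr p)) \<longlonglongrightarrow> ennreal (cmod (F0 r) powr p)"
      using \<open>0 < p\<close> by (intro tendsto_ennrealI tendsto_powr2 tendsto_norm lim tendsto_const) auto
    then show ?thesis using True by simp
  qed auto
  then have "(\<integral>\<^sup>+ r\<in>A. ennreal (cmod (F0 r) powr p) \<partial>lborel)
      = (\<integral>\<^sup>+ r. liminf (\<lambda>n. ennreal (cmod (F n r) powr p) * indicator A r) \<partial>lborel)"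
    by (intro nn_integral_cong) (metis lim_imp_Liminf trivial_limit_sequentially)
  also have "\<dots> \<le> liminf (\<lambda>n. \<integral>\<^sup>+ r\<in>A. ennreal (cmod (F n r) powr p) \<partial>lborel)"
    by (intro nn_integral_liminf) measurable
  also have "\<dots> \<le> b"
    using le by (intro Liminf_le) (auto intro: always_eventually)
  finally show ?thesis .
qed

text \<open>Lower semicontinuity in the angle: Fatou's lemma applies since \<open>f\<close> is
  continuous at each point of the radius.\<close>

lemma closed_radint_le:
  assumes f: "f \<in> analytic_disc" and "0 < p"
  shows "closed {t. radint p f 0 t \<le> b}"
  unfolding closed_sequential_limits
proof (intro allI impI, elim conjE)
  fix u :: "nat \<Rightarrow> real" and t assume u: "\<forall>n. u n \<in> {t. radint p f 0 t \<le> b}" and lim: "u \<longlonglongrightarrow> t"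
  have "(\<integral>\<^sup>+ r\<in>{0..<1}. ennreal (cmod (f (rcis r t)) powr p) \<partial>lborel) \<le> b"
  proof (rule nn_integral_powr_le_limit[where F="\<lambda>n r. f (rcis r (u n))"])
    fix r :: real assume r: "r \<in> {0..<1}"
    have "(\<lambda>n. rcis r (u n)) \<longlonglongrightarrow> rcis r t"
      unfolding rcis_def by (intro tendsto_intros lim)
    moreover have "isCont f (rcis r t)"
      using analytic_disc_continuous[OF f] r by (simp add: continuous_on_eq_continuous_at)
    ultimately show "(\<lambda>n. f (rcis r (u n))) \<longlonglongrightarrow> f (rcis r t)"
      using isCont_tendsto_compose by blast
  qed (use u assms radial_measurable in \<open>auto simp: radint_def\<close>)
  then show "t \<in> {t. radint p f 0 t \<le> b}" by (simp add: radint_def)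
qed

lemma radial_norm_measurable:
  assumes "f \<in> analytic_disc" "0 < p"
  shows "radial_norm p 0 f \<in> borel_measurable borel"
proof -
  have 1: "radint p f 0 \<in> borel_measurable borel"
    using closed_radint_le[OF assms] by (intro borel_measurableI_le) (simp add: borel_closed)
  have "(\<lambda>x. ennpowr x (1/p)) \<in> borel_measurable borel"
    unfolding ennpowr_def by measurable
  from measurable_compose[OF 1 this] show ?thesis
    by (simp add: radial_norm_radint[abs_def])
qed

text \<open>The exceptional set is open and null, hence empty. This turns an essential bound into a
  bound everywhere.\<close>

lemma closed_AE_imp_subset:
  fixes C :: "real set"
  assumes "closed C" and ae: "AE t in lborel. t \<in> {a<..<b} \<longrightarrow> t \<in> C"
  shows "{a<..<b} \<subseteq> C"
proof -
  let ?U = "{a<..<b} - C"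
  have "open ?U" using assms by auto
  moreover have "emeasure lborel ?U = 0"
    using ae by (subst (asm) AE_iff_measurable[where N="?U"]) (use \<open>closed C\<close> in auto)
  then have "?U \<in> null_sets lebesgue"
    using \<open>open ?U\<close> by (intro null_setsI) (auto simp: borel_open)
  then have "negligible ?U" by (simp add: negligible_iff_null_sets)
  ultimately have "?U = {}" using open_not_negligible by blast
  then show ?thesis by blast
qed

text \<open>The essential supremum is a true supremum: the sublevel set is closed, so it contains
  every angle of the period once it contains almost every one, and periodicity covers the rest of
  the line.\<close>

lemma rho_inf_le_iff:
  assumes f: "f \<in> analytic_disc" and "0 < p" "0 \<le> c"
  shows "rho_inf p f \<le> ennreal c \<longleftrightarrow> (\<forall>t. radint p f 0 t \<le> ennreal (c powr p))"
proof
  assume le: "rho_inf p f \<le> ennreal c"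
  define C where "C = {t. radint p f 0 t \<le> ennreal (c powr p)}"
  have cl: "closed C" unfolding C_def using assms by (intro closed_radint_le)
  have "AE t in restrict_space lborel {0..<2 * pi}. radial_norm p 0 f t \<le> rho_inf p f"
    unfolding rho_inf_def by (rule esssup_AE)
  then have "AE t in restrict_space lborel {0..<2 * pi}. t \<in> C"
    using le assms
    by (elim eventually_mono) (auto simp: C_def radial_norm_radint ennpowr_inverse_le_iff[symmetric])
  then have "AE t in lborel. t \<in> {0..<2*pi} \<longrightarrow> t \<in> C"
    by (simp add: AE_restrict_space_iff)
  then have "AE t in lborel. t \<in> {0<..<2*pi} \<longrightarrow> t \<in> C"
    by (elim eventually_mono) auto
  then have "{0<..<2*pi} \<subseteq> C" using closed_AE_imp_subset[OF cl] by blast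
  then have "closure {0<..<2*pi} \<subseteq> C" using cl by (rule closure_minimal)
  then have sub: "{0..2*pi} \<subseteq> C" by (simp add: closure_greaterThanLessThan)
  show "\<forall>t. radint p f 0 t \<le> ennreal (c powr p)"
  proof
    fix t :: real
    define k where "k = \<lfloor>t / (2 * pi)\<rfloor>"
    have "of_int k \<le> t / (2*pi)" "t / (2*pi) \<le> of_int k + 1" by (auto simp: k_def)
    then have "t + 2 * pi * of_int (-k) \<in> {0..2*pi}"
      by (simp add: field_simps)
    with sub have "t + 2 * pi * of_int (-k) \<in> C" by blast
    then show "radint p f 0 t \<le> ennreal (c powr p)" unfolding C_def mem_Collect_eq
      by (simp only: radint_periodic)
  qed
next
  assume "\<forall>t. radint p f 0 t \<le> ennreal (c powr p)"
  then show "rho_inf p f \<le> ennreal c"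
    unfolding rho_inf_def using radial_norm_measurable[of f p] assms
    by (intro esssup_I measurable_restrict_space1)
      (auto simp: radial_norm_radint ennpowr_inverse_le_iff)
qed

lemma RM_inf_iff:
  assumes "0 < p"
  shows "f \<in> RM_inf p \<longleftrightarrow> f \<in> analytic_disc \<and> (\<exists>c\<ge>0. \<forall>t. radint p f 0 t \<le> ennreal c)"
proof (cases "f \<in> analytic_disc")
  case True
  have "rho_inf p f < top \<longleftrightarrow> (\<exists>c\<ge>0. rho_inf p f \<le> ennreal c)"
    by (metis ennreal_less_top le_less_trans less_top_ennreal less_imp_le order_refl)
  also have "\<dots> \<longleftrightarrow> (\<exists>c\<ge>0. \<forall>t. radint p f 0 t \<le> ennreal (c powr p))"
    using rho_inf_le_iff[OF True assms] by blast
  also have "\<dots> \<longleftrightarrow> (\<exists>c\<ge>0. \<forall>t. radint p f 0 t \<le> ennreal c)"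
  proof safe
    fix c :: real assume "0 \<le> c" "\<forall>t. radint p f 0 t \<le> ennreal c"
    then show "\<exists>c\<ge>0. \<forall>t. radint p f 0 t \<le> ennreal (c powr p)"
      using assms by (intro exI[of _ "c powr (1/p)"]) (simp add: powr_powr)
  qed (auto intro: exI[of _ "_ powr p"])
  finally show ?thesis using True by (simp add: RM_inf_def)
qed (auto simp: RM_inf_def)

lemma RM_norm_le_iff:
  assumes "0 < p" "f \<in> RM_inf p" "0 \<le> c"
  shows "RM_norm p f \<le> c \<longleftrightarrow> (\<forall>t. radint p f 0 t \<le> ennreal (c powr p))"
proof -
  have "rho_inf p f = ennreal (RM_norm p f)"
    using assms by (simp add: RM_norm_def RM_inf_def)
  then have "RM_norm p f \<le> c \<longleftrightarrow> rho_inf p f \<le> ennreal c"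
    using \<open>0 \<le> c\<close> by simp
  then show ?thesis using rho_inf_le_iff[of f p c] assms by (simp add: RM_inf_def)
qed

lemma RM_norm_nonneg: "0 \<le> RM_norm p f"
  by (simp add: RM_norm_def)

lemma radint_le_RM_norm:
  assumes "0 < p" "f \<in> RM_inf p"
  shows "radint p f 0 t \<le> ennreal (RM_norm p f powr p)"
  using RM_norm_le_iff[OF assms RM_norm_nonneg] by blast

text \<open>Tail integrals decrease in \<open>s\<close>, so the limit at 1 amounts to one good
  \<open>s\<close> for each \<open>e\<close>; a bound \<open>e\<close> on the integral is a bound
  \<open>e powr (1 / p)\<close> on the norm.\<close>

lemma RM_zero_iff:
  assumes "0 < p"
  shows "f \<in> RM_zero p \<longleftrightarrow>
    f \<in> analytic_disc \<and> (\<forall>e>0. \<exists>s. 0 \<le> s \<and> s < 1 \<and> (\<forall>t. radint p f s t \<le> ennreal e))"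
proof -
  have "((\<lambda>s. SUP t. radial_norm p s f t) \<longlongrightarrow> 0) (at_left 1) \<longleftrightarrow>
     (\<forall>e>0. \<exists>s. 0 \<le> s \<and> s < 1 \<and> (\<forall>t. radint p f s t \<le> ennreal e))" (is "?L \<longleftrightarrow> ?R")
  proof
    assume L: ?L
    show ?R
    proof (intro allI impI)
      fix e :: real assume "e > 0"
      then have "eventually (\<lambda>s. (SUP t. radial_norm p s f t) < ennreal (e powr (1/p))) (at_left 1)"
        using L by (intro order_tendstoD(2)[where y=0]) auto
      moreover have "eventually (\<lambda>s. s \<in> {0<..<1}) (at_left (1::real))"
        by (rule eventually_at_left_real) simp
      ultimately have "eventually (\<lambda>s. (SUP t. radial_norm p s f t) < ennreal (e powr (1/p)) \<and> s \<in> {0<..<1})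
          (at_left 1)" by (rule eventually_conj)
      then obtain s where s: "(SUP t. radial_norm p s f t) < ennreal (e powr (1/p))" "s \<in> {0<..<1}"
        using eventually_happens trivial_limit_at_left_real by blast
      have "radial_norm p s f t \<le> ennreal (e powr (1/p))" for t
        using s(1) by (meson SUP_upper UNIV_I less_imp_le order_trans)
      then have "\<forall>t. radint p f s t \<le> ennreal e"
        using assms \<open>e > 0\<close> by (auto simp: radial_norm_radint ennpowr_inverse_le_iff powr_powr)
      then show "\<exists>s. 0 \<le> s \<and> s < 1 \<and> (\<forall>t. radint p f s t \<le> ennreal e)"
        using s(2) by (intro exI[of _ s]) simp
    qed
  next
    assume R: ?R
    show ?L
    proof (rule order_tendstoI)
      fix a :: ennreal assume "0 < a"
      then obtain e where e: "0 < e" "ennreal e < a"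
        by (metis dense ennreal_eq_0_iff ennreal_less_zero_iff le_less_linear less_top_ennreal not_gr_zero order_less_le_trans top_greatest leD linorder_not_le)
      obtain s where s: "0 \<le> s" "s < 1" "\<And>t. radint p f s t \<le> ennreal (e powr p)"
        using R[rule_format, of "e powr p"] e by auto
      have "(SUP t. radial_norm p x f t) < a" if "s < x" for x
      proof -
        have "radial_norm p x f t \<le> ennreal e" for t
          unfolding radial_norm_radint using e s(3)[of t] assms that radint_mono[of s x p f t]
          by (subst ennpowr_inverse_le_iff) (auto intro: order_trans)
        then show ?thesis using e(2) by (meson SUP_least le_less_trans)
      qed
      then show "\<forall>\<^sub>F x in at_left 1. (SUP t. radial_norm p x f t) < a"
        using s(2) unfolding eventually_at_left_field by blast
    qed auto
  qed
  then show ?thesis by (auto simp: RM_zero_def)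
qed

section \<open>Both spaces are closed under sums and scalar multiples\<close>

lemma add_powr_le:
  fixes x y p :: real
  assumes "0 \<le> x" "0 \<le> y" "0 \<le> p"
  shows "(x + y) powr p \<le> 2 powr p * (x powr p + y powr p)"
proof -
  have "(x + y) powr p \<le> (2 * max x y) powr p"
    using assms by (intro powr_mono2) auto
  also have "\<dots> = 2 powr p * max x y powr p"
    using assms by (simp add: powr_mult)
  also have "max x y powr p \<le> x powr p + y powr p"
    by (simp add: max_def)
  finally show ?thesis by simp
qed

text \<open>A crude substitute for Minkowski's inequality: the constant \<open>2 powr p\<close> does
  no harm where only finiteness or smallness is at stake.\<close>

lemma nn_integral_add_powr_le:
  fixes F G :: "real \<Rightarrow> complex"
  assumes "0 \<le> p" and [measurable]: "F \<in> borel_measurable borel" "G \<in> borel_measurable borel"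
    and [measurable]: "A \<in> sets borel"
  shows "(\<integral>\<^sup>+ r\<in>A. ennreal (cmod (F r + G r) powr p) \<partial>lborel)
    \<le> ennreal (2 powr p) * ((\<integral>\<^sup>+ r\<in>A. ennreal (cmod (F r) powr p) \<partial>lborel) +
        (\<integral>\<^sup>+ r\<in>A. ennreal (cmod (G r) powr p) \<partial>lborel))"
proof -
  have "ennreal (cmod (F r + G r) powr p) \<le>
      ennreal (2 powr p) * (ennreal (cmod (F r) powr p) + ennreal (cmod (G r) powr p))" for r
  proof -
    have "cmod (F r + G r) powr p \<le> (cmod (F r) + cmod (G r)) powr p"
      using assms by (intro powr_mono2 norm_triangle_ineq) auto
    also have "\<dots> \<le> 2 powr p * (cmod (F r) powr p + cmod (G r) powr p)"
      using assms by (intro add_powr_le) auto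
    finally show ?thesis
      by (simp flip: ennreal_plus ennreal_mult)
  qed
  then have "(\<integral>\<^sup>+ r\<in>A. ennreal (cmod (F r + G r) powr p) \<partial>lborel) \<le>
      (\<integral>\<^sup>+ r. ennreal (2 powr p) * (ennreal (cmod (F r) powr p) * indicator A r
         + ennreal (cmod (G r) powr p) * indicator A r) \<partial>lborel)"
    by (intro nn_integral_mono) (auto simp: indicator_def)
  also have "\<dots> = ennreal (2 powr p) * ((\<integral>\<^sup>+ r\<in>A. ennreal (cmod (F r) powr p) \<partial>lborel) +
        (\<integral>\<^sup>+ r\<in>A. ennreal (cmod (G r) powr p) \<partial>lborel))"
    by (simp add: nn_integral_cmult nn_integral_add)
  finally show ?thesis .
qed

lemma radint_add_le:
  assumes "0 \<le> p" "f \<in> analytic_disc" "g \<in> analytic_disc"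
  shows "radint p (\<lambda>z. f z + g z) s t \<le> ennreal (2 powr p) * (radint p f s t + radint p g s t)"
  unfolding radint_def using assms by (intro nn_integral_add_powr_le radial_measurable) auto

lemma radint_scale:
  assumes "f \<in> analytic_disc"
  shows "radint p (\<lambda>z. c * f z) s t = ennreal (cmod c powr p) * radint p f s t"
proof -
  note [measurable] = radial_measurable[OF assms]
  show ?thesis unfolding radint_def
    by (subst nn_integral_cmult[symmetric])
       (auto simp: norm_mult powr_mult ennreal_mult mult.assoc)
qed

lemma analytic_disc_add: "f \<in> analytic_disc \<Longrightarrow> g \<in> analytic_disc \<Longrightarrow> (\<lambda>z. f z + g z) \<in> analytic_disc"
  by (auto simp: analytic_disc_def intro: holomorphic_intros)

lemma analytic_disc_scale: "f \<in> analytic_disc \<Longrightarrow> (\<lambda>z. c * f z) \<in> analytic_disc"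
  by (auto simp: analytic_disc_def intro: holomorphic_intros)

lemma analytic_disc_bounded:
  assumes "f \<in> analytic_disc" "R < 1"
  obtains M where "0 < M" "\<And>z. cmod z \<le> R \<Longrightarrow> cmod (f z) \<le> M"
proof -
  have "continuous_on (cball 0 R) f"
    using \<open>R < 1\<close> by (intro continuous_on_subset[OF analytic_disc_continuous[OF assms(1)]]) auto
  then have "bounded (f ` cball 0 R)"
    by (intro compact_imp_bounded compact_continuous_image) auto
  then obtain M where "0 < M" "\<forall>x\<in>f ` cball 0 R. cmod x \<le> M"
    unfolding bounded_pos by blast
  then show ?thesis using that[of M] by auto
qed

text \<open>The radius is split at \<open>s\<close>; the inner piece \<open>{0..<s}\<close> has
  length at most 1.\<close>

lemma radint_le_tail:
  assumes f: "f \<in> analytic_disc" and "0 < p" "0 \<le> s" "s \<le> 1"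
    and M: "\<And>z. cmod z \<le> s \<Longrightarrow> cmod (f z) \<le> M"
  shows "radint p f 0 t \<le> ennreal (M powr p) + radint p f s t"
proof -
  note [measurable] = radial_measurable[OF f]
  have "radint p f 0 t \<le> (\<integral>\<^sup>+ r. ennreal (M powr p) * indicator {0..<s} r +
      ennreal (cmod (f (rcis r t)) powr p) * indicator {s..<1} r \<partial>lborel)"
    unfolding radint_def
  proof (intro nn_integral_mono)
    fix r :: real
    have "cmod (f (rcis r t)) powr p \<le> M powr p" if "0 \<le> r" "r < s"
      using that assms by (intro powr_mono2 M) auto
    then show "ennreal (cmod (f (rcis r t)) powr p) * indicator {0..<1} r
         \<le> ennreal (M powr p) * indicator {0..<s} r +
           ennreal (cmod (f (rcis r t)) powr p) * indicator {s..<1} r"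
      using \<open>0 \<le> s\<close> by (auto simp: indicator_def)
  qed
  also have "\<dots> = ennreal (M powr p) * emeasure lborel {0..<s} + radint p f s t"
    by (simp add: nn_integral_add nn_integral_cmult_indicator radint_def)
  also have "\<dots> \<le> ennreal (M powr p) * 1 + radint p f s t"
    using assms by (intro add_mono mult_mono) auto
  finally show ?thesis by simp
qed

lemma RM_zero_subset_RM_inf:
  assumes "0 < p" shows "RM_zero p \<subseteq> RM_inf p"
proof
  fix f assume f: "f \<in> RM_zero p"
  then obtain s where s: "0 \<le> s" "s < 1" "\<And>t. radint p f s t \<le> ennreal 1"
    using assms unfolding RM_zero_iff[OF assms] by (metis zero_less_one)
  have fa: "f \<in> analytic_disc" using f by (simp add: RM_zero_def)
  obtain M where M: "0 < M" "\<And>z. cmod z \<le> s \<Longrightarrow> cmod (f z) \<le> M"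
    using analytic_disc_bounded[OF fa s(2)] by blast
  have "radint p f 0 t \<le> ennreal (M powr p + 1)" for t
  proof -
    have "radint p f 0 t \<le> ennreal (M powr p) + radint p f s t"
      using s M by (intro radint_le_tail fa assms) auto
    also have "\<dots> \<le> ennreal (M powr p) + ennreal 1" using s by (intro add_mono) auto
    finally show ?thesis by simp
  qed
  then show "f \<in> RM_inf p" using fa unfolding RM_inf_iff[OF assms]
    by (intro conjI exI[of _ "M powr p + 1"]) auto
qed

lemma RM_inf_add:
  assumes "0 < p" "f \<in> RM_inf p" "g \<in> RM_inf p"
  shows "(\<lambda>z. f z + g z) \<in> RM_inf p"
proof -
  obtain a b where ab: "0 \<le> a" "0 \<le> b" "\<And>t. radint p f 0 t \<le> ennreal a" "\<And>t. radint p g 0 t \<le> ennreal b"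
    using assms RM_inf_iff by metis
  have fg: "f \<in> analytic_disc" "g \<in> analytic_disc" using assms by (auto simp: RM_inf_def)
  have "radint p (\<lambda>z. f z + g z) 0 t \<le> ennreal (2 powr p * (a + b))" for t
  proof -
    have "radint p (\<lambda>z. f z + g z) 0 t \<le> ennreal (2 powr p) * (radint p f 0 t + radint p g 0 t)"
      using assms fg by (intro radint_add_le) auto
    also have "\<dots> \<le> ennreal (2 powr p) * (ennreal a + ennreal b)"
      by (intro mult_left_mono add_mono ab) auto
    finally show ?thesis using ab by (simp add: ennreal_mult)
  qed
  then show ?thesis unfolding RM_inf_iff[OF assms(1)]
    using ab by (intro conjI exI[of _ "2 powr p * (a + b)"] analytic_disc_add fg) auto
qed

lemma RM_inf_scale:
  assumes "0 < p" "f \<in> RM_inf p"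
  shows "(\<lambda>z. c * f z) \<in> RM_inf p"
proof -
  obtain a where a: "0 \<le> a" "\<And>t. radint p f 0 t \<le> ennreal a"
    using assms RM_inf_iff by metis
  have f: "f \<in> analytic_disc" using assms by (auto simp: RM_inf_def)
  have "radint p (\<lambda>z. c * f z) 0 t \<le> ennreal (cmod c powr p * a)" for t
    using a by (simp add: radint_scale[OF f] ennreal_mult mult_left_mono)
  then show ?thesis unfolding RM_inf_iff[OF assms(1)]
    using a by (intro conjI exI[of _ "cmod c powr p * a"] analytic_disc_scale f) auto
qed

lemma RM_zero_add:
  assumes "0 < p" "f \<in> RM_zero p" "g \<in> RM_zero p"
  shows "(\<lambda>z. f z + g z) \<in> RM_zero p"
proof -
  have fg: "f \<in> analytic_disc" "g \<in> analytic_disc" using assms by (auto simp: RM_zero_def)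
  show ?thesis unfolding RM_zero_iff[OF assms(1)]
  proof (intro conjI allI impI analytic_disc_add fg)
    fix e :: real assume "0 < e"
    \<comment> \<open>Chosen so that \<open>2 powr p * (d + d) = e\<close>.\<close>
    define d where "d = e / (2 * 2 powr p)"
    have "0 < d" using \<open>0 < e\<close> by (simp add: d_def)
    obtain s where s: "0 \<le> s" "s < 1" "\<And>t. radint p f s t \<le> ennreal d"
      using assms \<open>0 < d\<close> unfolding RM_zero_iff[OF assms(1)] by metis
    obtain s' where s': "0 \<le> s'" "s' < 1" "\<And>t. radint p g s' t \<le> ennreal d"
      using assms \<open>0 < d\<close> unfolding RM_zero_iff[OF assms(1)] by metis
    have "radint p (\<lambda>z. f z + g z) (max s s') t \<le> ennreal e" for t
    proof -
      have "radint p (\<lambda>z. f z + g z) (max s s') t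
          \<le> ennreal (2 powr p) * (radint p f (max s s') t + radint p g (max s s') t)"
        using assms fg by (intro radint_add_le) auto
      also have "\<dots> \<le> ennreal (2 powr p) * (ennreal d + ennreal d)"
        using s(3)[of t] s'(3)[of t]
        by (intro mult_left_mono add_mono order_trans[OF radint_mono[of s "max s s'"]]
              order_trans[OF radint_mono[of s' "max s s'"]]) auto
      also have "\<dots> = ennreal e" using \<open>0 < d\<close> \<open>0 < e\<close>
        by (simp add: d_def flip: ennreal_plus ennreal_mult)
      finally show ?thesis .
    qed
    then show "\<exists>s\<ge>0. s < 1 \<and> (\<forall>t. radint p (\<lambda>z. f z + g z) s t \<le> ennreal e)"
      using s s' by (intro exI[of _ "max s s'"]) auto
  qed
qed

lemma RM_zero_scale:
  assumes "0 < p" "f \<in> RM_zero p"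
  shows "(\<lambda>z. c * f z) \<in> RM_zero p"
proof -
  have f: "f \<in> analytic_disc" using assms by (auto simp: RM_zero_def)
  show ?thesis unfolding RM_zero_iff[OF assms(1)]
  proof (intro conjI allI impI analytic_disc_scale f)
    fix e :: real assume "0 < e"
    \<comment> \<open>Adding 1 keeps the denominator positive when \<open>c = 0\<close>.\<close>
    define d where "d = e / (cmod c powr p + 1)"
    have pos: "0 < cmod c powr p + 1" by (simp add: add_nonneg_pos)
    then have "0 < d" using \<open>0 < e\<close> by (simp add: d_def)
    obtain s where s: "0 \<le> s" "s < 1" "\<And>t. radint p f s t \<le> ennreal d"
      using assms \<open>0 < d\<close> unfolding RM_zero_iff[OF assms(1)] by metis
    have "radint p (\<lambda>z. c * f z) s t \<le> ennreal e" for t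
    proof -
      have "radint p (\<lambda>z. c * f z) s t \<le> ennreal (cmod c powr p) * ennreal d"
        using s by (simp add: radint_scale[OF f] mult_left_mono)
      also have "\<dots> \<le> ennreal e" using \<open>0 < e\<close> pos
        by (simp add: d_def field_simps flip: ennreal_mult)
      finally show ?thesis .
    qed
    then show "\<exists>s\<ge>0. s < 1 \<and> (\<forall>t. radint p (\<lambda>z. c * f z) s t \<le> ennreal e)"
      using s by blast
  qed
qed

section \<open>Hardy's inequality and boundedness of the integration operator\<close>

text \<open>Young's inequality with the factor 1/2 on the first term, so that Hardy's argument can
  absorb it. Comparing \<open>x\<close> with \<open>2 * p * y\<close> gives an explicit constant
  without conjugate exponents.\<close>

lemma Young_by_cases:
  fixes x y p :: real
  assumes "1 < p" "0 < x" "0 \<le> y"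
  shows "p * x powr (p - 1) * y \<le> x powr p / 2 + (2 * p) powr p * y powr p"
proof (cases "2 * p * y \<le> x")
  case True
  have "x powr (p - 1) * (2 * p * y) \<le> x powr (p - 1) * x"
    using True by (intro mult_left_mono) auto
  also have "\<dots> = x powr p" using assms by (simp add: powr_diff)
  finally have "p * x powr (p - 1) * y \<le> x powr p / 2" by (simp add: mult_ac)
  moreover have "0 \<le> (2 * p) powr p * y powr p" by simp
  ultimately show ?thesis by linarith
next
  case False
  then have y: "0 < y" using assms by (cases "y = 0") auto
  have "p * x powr (p - 1) * y \<le> p * (2 * p * y) powr (p - 1) * y"
    using False assms y by (intro mult_right_mono mult_left_mono powr_mono2) auto
  also have "\<dots> \<le> (2 * p * y) powr (p - 1) * (2 * p * y)"
    using assms y by (simp add: mult_ac)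
  also have "\<dots> = (2 * p * y) powr p" using assms y by (simp add: powr_diff)
  also have "\<dots> = (2 * p) powr p * y powr p" using assms y by (simp add: powr_mult)
  finally have "p * x powr (p - 1) * y \<le> (2 * p) powr p * y powr p" .
  moreover have "0 \<le> x powr p" by simp
  ultimately show ?thesis by linarith
qed

text \<open>Integrate the derivative \<open>- H powr p + p * H powr (p - 1) * h\<close> of
  \<open>(1 - r) * H powr p\<close> and absorb half of the first term.\<close>

lemma Hardy_interval:
  fixes H h :: "real \<Rightarrow> real"
  assumes "1 < p" "a \<le> R" "R < 1"
    and pos: "\<And>r. r \<in> {a..R} \<Longrightarrow> 0 < H r" "\<And>r. r \<in> {a..R} \<Longrightarrow> 0 \<le> h r"
    and deriv: "\<And>r. r \<in> {a..R} \<Longrightarrow> (H has_real_derivative h r / (1 - r)) (at r within {a..R})"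
    and cont: "continuous_on {a..R} h"
  shows "integral {a..R} (\<lambda>r. H r powr p) \<le>
     2 * (1 - a) * H a powr p + 2 * (2 * p) powr p * integral {a..R} (\<lambda>r. h r powr p)"
proof -
  define G where "G r = (1 - r) * H r powr p" for r
  define G' where "G' r = - (H r powr p) + p * H r powr (p - 1) * h r" for r
  have cH: "continuous_on {a..R} H"
    using deriv by (rule DERIV_continuous_on)
  have "(G has_real_derivative G' r) (at r within {a..R})" if r: "r \<in> {a..R}" for r
  proof -
    have "((\<lambda>r. H r powr p) has_real_derivative (p * H r powr (p - 1)) * (h r / (1 - r))) (at r within {a..R})"
      using deriv[OF r] has_real_derivative_powr[OF pos(1)[OF r], of p]
      by (rule DERIV_chain2[rotated])
    moreover have "((\<lambda>r. 1 - r) has_real_derivative -1) (at r within {a..R})"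
      by (auto intro!: derivative_eq_intros)
    ultimately have "(G has_real_derivative
        (-1) * H r powr p + (p * H r powr (p - 1) * (h r / (1 - r))) * (1 - r)) (at r within {a..R})"
      unfolding G_def by (rule DERIV_mult[rotated])
    moreover have "1 - r \<noteq> 0" using r assms by auto
    ultimately show ?thesis by (simp add: G'_def)
  qed
  then have 1: "(G' has_integral (G R - G a)) {a..R}"
    using \<open>a \<le> R\<close> by (intro fundamental_theorem_of_calculus)
      (auto simp: has_real_derivative_iff_has_vector_derivative)
  have i1: "(\<lambda>r. H r powr p) integrable_on {a..R}"
    using pos assms by (intro integrable_continuous_interval continuous_on_powr' cH continuous_on_const) force+
  have i2: "(\<lambda>r. h r powr p) integrable_on {a..R}"
    using pos assms by (intro integrable_continuous_interval continuous_on_powr' cont continuous_on_const) force+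
  have 2: "((\<lambda>r. - (1/2) * H r powr p + (2 * p) powr p * h r powr p) has_integral
      - (1/2) * integral {a..R} (\<lambda>r. H r powr p) + (2 * p) powr p * integral {a..R} (\<lambda>r. h r powr p)) {a..R}"
    using i1 i2 by (intro has_integral_add has_integral_mult_right integrable_integral)
  have "G R - G a \<le> - (1/2) * integral {a..R} (\<lambda>r. H r powr p) + (2 * p) powr p * integral {a..R} (\<lambda>r. h r powr p)"
  proof (rule has_integral_le[OF 1 2])
    fix r assume r: "r \<in> {a..R}"
    show "G' r \<le> - (1/2) * H r powr p + (2 * p) powr p * h r powr p"
      using Young_by_cases[OF \<open>1 < p\<close> pos(1)[OF r] pos(2)[OF r]] by (simp add: G'_def)
  qed
  \<comment> \<open>Dropping the nonnegative boundary term at \<open>R\<close> keeps the bound free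
    of \<open>R\<close> except in the integrals.\<close>
  moreover have "0 \<le> G R" using assms by (simp add: G_def)
  ultimately have "integral {a..R} (\<lambda>r. H r powr p) \<le>
      2 * G a + 2 * ((2 * p) powr p * integral {a..R} (\<lambda>r. h r powr p))" by linarith
  then show ?thesis by (simp only: G_def mult.assoc)
qed

text \<open>The modulus of \<open>u\<close> may vanish and fail to be differentiable there. It is
  replaced by the majorant \<open>d + integral {a..r} k\<close> with
  \<open>k r = h r / (1 - r)\<close>, which is positive and differentiable; the cost of
  \<open>d\<close> is made arbitrarily small.\<close>

lemma Hardy_interval_complex:
  fixes u u' :: "real \<Rightarrow> complex" and h :: "real \<Rightarrow> real"
  assumes "1 < p" "a \<le> R" "R < 1" "u a = 0"
    and deriv: "\<And>r. r \<in> {a..R} \<Longrightarrow> (u has_vector_derivative u' r) (at r within {a..R})"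
    and le: "\<And>r. r \<in> {a..R} \<Longrightarrow> cmod (u' r) \<le> h r / (1 - r)"
    and cont: "continuous_on {a..R} h"
  shows "integral {a..R} (\<lambda>r. cmod (u r) powr p) \<le> 2 * (2 * p) powr p * integral {a..R} (\<lambda>r. h r powr p)"
proof (rule field_le_epsilon)
  fix e :: real assume "0 < e"
  \<comment> \<open>As \<open>H a = d\<close>, this is the value for which the boundary term
    \<open>2 * (1 - a) * H a powr p\<close> equals \<open>e\<close>.\<close>
  define d where "d = (e / (2 * (1 - a))) powr (1 / p)"
  have a1: "0 < 1 - a" using assms by simp
  then have "0 < d" using \<open>0 < e\<close> by (simp add: d_def)
  have dp: "2 * (1 - a) * d powr p = e" using a1 \<open>0 < e\<close> \<open>1 < p\<close> by (simp add: d_def powr_powr)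
  define k where "k r = h r / (1 - r)" for r
  define H where "H r = d + integral {a..r} k" for r
  have h0: "0 \<le> h r" if "r \<in> {a..R}" for r
    
  proof -
    have "0 \<le> h r / (1 - r)" "0 < 1 - r" using le[OF that] that assms order_trans[OF norm_ge_zero] by auto
    then show ?thesis by (simp add: zero_le_divide_iff)
  qed
  have ck: "continuous_on {a..R} k"
    unfolding k_def using assms by (intro continuous_intros cont) auto
  have uH: "cmod (u r) \<le> integral {a..r} k" if r: "r \<in> {a..R}" for r
  proof -
    have "(u' has_integral (u r - u a)) {a..r}"
      using r by (intro fundamental_theorem_of_calculus has_vector_derivative_within_subset[OF deriv]) auto
    then have u: "u' integrable_on {a..r}" "integral {a..r} u' = u r"
      using \<open>u a = 0\<close> by auto
    have "cmod (integral {a..r} u') \<le> integral {a..r} k"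
      using r le by (intro integral_norm_bound_integral u integrable_continuous_interval
        continuous_on_subset[OF ck]) (auto simp: k_def)
    then show ?thesis using u by simp
  qed
  have cu: "continuous_on {a..R} u"
    using deriv by (rule continuous_on_vector_derivative)
  have H0: "0 < H r" if "r \<in> {a..R}" for r
    using uH[OF that] \<open>0 < d\<close> norm_ge_zero[of "u r"] unfolding H_def by linarith
  have Hd: "(H has_real_derivative h r / (1 - r)) (at r within {a..R})" if "r \<in> {a..R}" for r
    using integral_has_real_derivative[OF ck that] unfolding H_def k_def
    by (auto intro!: derivative_eq_intros)
  have cH: "continuous_on {a..R} H" using Hd by (rule DERIV_continuous_on)
  have "integral {a..R} (\<lambda>r. cmod (u r) powr p) \<le> integral {a..R} (\<lambda>r. H r powr p)"
  proof (rule integral_le)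
    show "(\<lambda>r. cmod (u r) powr p) integrable_on {a..R}"
      using assms by (intro integrable_continuous_interval continuous_on_powr' continuous_intros cu) auto
    show "(\<lambda>r. H r powr p) integrable_on {a..R}"
      using H0 assms by (intro integrable_continuous_interval continuous_on_powr' continuous_intros cH) force+
    show "cmod (u r) powr p \<le> H r powr p" if "r \<in> {a..R}" for r
      using uH[OF that] \<open>0 < d\<close> assms by (intro powr_mono2) (auto simp: H_def)
  qed
  also have "\<dots> \<le> 2 * (1 - a) * H a powr p + 2 * (2 * p) powr p * integral {a..R} (\<lambda>r. h r powr p)"
    using assms H0 h0 Hd by (intro Hardy_interval) auto
  finally show "integral {a..R} (\<lambda>r. cmod (u r) powr p)
     \<le> 2 * (2 * p) powr p * integral {a..R} (\<lambda>r. h r powr p) + e"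
    using dp by (simp add: H_def)
qed

text \<open>The constant on \<open>{a..R}\<close> does not depend on \<open>R\<close>, so Fatou's
  lemma, applied to \<open>u\<close> cut off beyond \<open>R n\<close>, lets \<open>R\<close> tend
  to 1.\<close>

lemma Hardy_nn_integral:
  fixes u u' :: "real \<Rightarrow> complex" and h :: "real \<Rightarrow> real"
  assumes "1 < p" "a < 1" "u a = 0"
    and deriv: "\<And>r. r \<in> {a..<1} \<Longrightarrow> (u has_vector_derivative u' r) (at r)"
    and le: "\<And>r. r \<in> {a..<1} \<Longrightarrow> cmod (u' r) \<le> h r / (1 - r)"
    and cont: "continuous_on {a..<1} h"
    and meas: "u \<in> borel_measurable borel"
  shows "(\<integral>\<^sup>+ r\<in>{a..<1}. ennreal (cmod (u r) powr p) \<partial>lborel)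
    \<le> ennreal (2 * (2 * p) powr p) * (\<integral>\<^sup>+ r\<in>{a..<1}. ennreal (h r powr p) \<partial>lborel)"
proof -
  define R where "R n = 1 - (1 - a) / (real n + 1)" for n
  have R: "a \<le> R n" "R n < 1" for n 
  proof -
    have "1 - a > 0" using \<open>a < 1\<close> by simp
    then have "(1 - a) / (real n + 1) \<le> (1 - a) / 1" "0 < (1 - a) / (real n + 1)"
      by (intro divide_left_mono divide_pos_pos; simp)+
    then show "a \<le> R n" "R n < 1" by (auto simp: R_def)
  qed
  have Rlim: "R \<longlonglongrightarrow> 1"
    unfolding R_def by real_asymp
  have h0: "0 \<le> h r" if "r \<in> {a..<1}" for r
    
  proof -
    have "0 \<le> h r / (1 - r)" "0 < 1 - r" using le[OF that] that assms order_trans[OF norm_ge_zero] by auto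
    then show ?thesis by (simp add: zero_le_divide_iff)
  qed
  have cu: "continuous_on {a..R n} u" for n
    by (rule continuous_on_vector_derivative, rule has_vector_derivative_at_within, rule deriv)
       (use R(2)[of n] in auto)
  have ch: "continuous_on {a..R n} h" for n
    using R[of n] by (intro continuous_on_subset[OF cont]) auto
  show ?thesis
  proof (rule nn_integral_powr_le_limit[where F="\<lambda>n r. if r \<le> R n then u r else 0"])
    fix n
    have "(\<integral>\<^sup>+ r\<in>{a..<1}. ennreal (cmod (if r \<le> R n then u r else 0) powr p) \<partial>lborel)
        = (\<integral>\<^sup>+ r\<in>{a..R n}. ennreal (cmod (u r) powr p) \<partial>lborel)"
      using R[of n] assms by (intro nn_integral_cong) (auto simp: indicator_def)
    also have "\<dots> = ennreal (integral {a..R n} (\<lambda>r. cmod (u r) powr p))"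
      using assms by (intro nn_integral_has_integral_lebesgue' integrable_integral
         integrable_continuous_interval continuous_on_powr' continuous_intros cu) auto
    also have "\<dots> \<le> ennreal (2 * (2 * p) powr p * integral {a..R n} (\<lambda>r. h r powr p))"
      by (intro ennreal_leI Hardy_interval_complex[where u'=u'] ch le has_vector_derivative_at_within[OF deriv])
        (use R[of n] assms in auto)
    also have "\<dots> = ennreal (2 * (2 * p) powr p) * ennreal (integral {a..R n} (\<lambda>r. h r powr p))"
      by (simp add: ennreal_mult')
    also have "ennreal (integral {a..R n} (\<lambda>r. h r powr p)) = (\<integral>\<^sup>+ r\<in>{a..R n}. ennreal (h r powr p) \<partial>lborel)"
      using assms R[of n] h0 by (intro nn_integral_has_integral_lebesgue'[symmetric] integrable_integral
         integrable_continuous_interval continuous_on_powr' continuous_intros ch) force+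
    also have "\<dots> \<le> (\<integral>\<^sup>+ r\<in>{a..<1}. ennreal (h r powr p) \<partial>lborel)"
      using R[of n] by (intro nn_integral_mono) (auto simp: indicator_def)
    finally show "(\<integral>\<^sup>+ r\<in>{a..<1}. ennreal (cmod (if r \<le> R n then u r else 0) powr p) \<partial>lborel)
       \<le> ennreal (2 * (2 * p) powr p) * (\<integral>\<^sup>+ r\<in>{a..<1}. ennreal (h r powr p) \<partial>lborel)"
      by (simp add: mult_left_mono)
  next
    fix r assume r: "r \<in> {a..<1}"
    have "eventually (\<lambda>n. r < R n) sequentially"
      using Rlim r by (intro order_tendstoD(1)) auto
    then show "(\<lambda>n. if r \<le> R n then u r else 0) \<longlonglongrightarrow> u r"
      by (intro tendsto_eventually) (elim eventually_mono, simp)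
  qed (use assms in auto)
qed

section \<open>The integration operator: derivative, linearity and boundedness\<close>

lemma bloch_deriv_bound:
  assumes "g \<in> bloch"
  obtains B where "0 < B" "\<And>z. cmod z < 1 \<Longrightarrow> cmod (deriv g z) \<le> B / (1 - cmod z)"
proof -
  obtain b where b: "\<And>z. cmod z < 1 \<Longrightarrow> (1 - (cmod z)\<^sup>2) * cmod (deriv g z) \<le> b"
    using assms unfolding bloch_def bdd_above_def by fastforce
  \<comment> \<open>The weight \<open>1 - cmod z\<close>, which is below the Bloch weight, is the
    one in Hardy's inequality. The shift by 1 makes the constant strictly positive.\<close>
  have "cmod (deriv g z) \<le> (\<bar>b\<bar> + 1) / (1 - cmod z)" if z: "cmod z < 1" for z
  proof -
    have "(1 - cmod z) * cmod (deriv g z) \<le> (1 - (cmod z)\<^sup>2) * cmod (deriv g z)"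
      using z by (intro mult_right_mono) (auto simp: power2_eq_square mult_left_le)
    also have "\<dots> \<le> \<bar>b\<bar> + 1" using b[OF z] by linarith
    finally show ?thesis using z by (simp add: field_simps)
  qed
  then show ?thesis using that[of "\<bar>b\<bar> + 1"] by auto
qed

lemma bloch_analytic_disc: "g \<in> bloch \<Longrightarrow> g \<in> analytic_disc"
  by (simp add: bloch_def)

lemma integrand_holomorphic:
  assumes "f \<in> analytic_disc" "g \<in> analytic_disc"
  shows "(\<lambda>w. f w * deriv g w) holomorphic_on ball 0 1"
  using assms by (intro holomorphic_intros analytic_disc_holomorphic) auto

lemma segment_in_cball: "closed_segment 0 z \<subseteq> cball 0 (cmod z)"
  by (intro closed_segment_subset) auto

lemma integrand_contour_integrable:
  assumes "f \<in> analytic_disc" "g \<in> analytic_disc" "cmod z < 1"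
  shows "(\<lambda>w. f w * deriv g w) contour_integrable_on linepath 0 z"
  using segment_in_cball[of z] assms
  by (intro contour_integrable_continuous_linepath continuous_on_subset
      [OF holomorphic_on_imp_continuous_on[OF integrand_holomorphic]]) auto

lemma integration_op_primitive:
  assumes f: "f \<in> analytic_disc" and g: "g \<in> analytic_disc"
  obtains P where "\<And>z. cmod z < 1 \<Longrightarrow> (P has_field_derivative f z * deriv g z) (at z)"
    "\<And>z. cmod z < 1 \<Longrightarrow> integration_op g f z = P z - P 0"
proof -
  obtain P where P: "\<And>z. z \<in> ball 0 1 \<Longrightarrow> (P has_field_derivative f z * deriv g z) (at z within ball 0 1)"
    using holomorphic_convex_primitive'[OF convex_ball open_ball integrand_holomorphic[OF f g]] by blast
  have "contour_integral (linepath 0 z) (\<lambda>w. f w * deriv g w) = P z - P 0" if "cmod z < 1" for z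
  proof -
    have "path_image (linepath 0 z) \<subseteq> ball 0 1" using segment_in_cball[of z] that by auto
    from contour_integral_primitive[OF P _ this] show ?thesis
      by (intro contour_integral_unique) simp
  qed
  then have 1: "integration_op g f z = P z - P 0" if "cmod z < 1" for z
    using that by (simp add: integration_op_def)
  have 2: "(P has_field_derivative f z * deriv g z) (at z)" if "cmod z < 1" for z
    using P[of z] that by (simp add: at_within_open[OF _ open_ball])
  show ?thesis using that 1 2 by blast
qed

lemma integration_op_deriv:
  assumes f: "f \<in> analytic_disc" and g: "g \<in> analytic_disc" and z: "cmod z < 1"
  shows "(integration_op g f has_field_derivative f z * deriv g z) (at z)"
proof -
  obtain P where P: "\<And>z. cmod z < 1 \<Longrightarrow> (P has_field_derivative f z * deriv g z) (at z)"
    "\<And>z. cmod z < 1 \<Longrightarrow> integration_op g f z = P z - P 0"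
    using integration_op_primitive[OF f g] by blast
  have "((\<lambda>z. P z - P 0) has_field_derivative f z * deriv g z) (at z)"
    using P(1)[OF z] by (auto intro!: derivative_eq_intros)
  then show ?thesis
    by (rule has_field_derivative_transform_within_open[OF _ open_ball[of 0 1]]) (use z P(2) in auto)
qed

lemma integration_op_analytic_disc:
  assumes f: "f \<in> analytic_disc" and g: "g \<in> analytic_disc"
  shows "integration_op g f \<in> analytic_disc"
proof -
  have "integration_op g f holomorphic_on ball 0 1"
    unfolding holomorphic_on_open[OF open_ball] using integration_op_deriv[OF f g] by fastforce
  then show ?thesis by (simp add: analytic_disc_def integration_op_def)
qed

lemma integration_op_0 [simp]: "integration_op g f 0 = 0"
  by (simp add: integration_op_def)

lemma integration_op_add:
  assumes "f \<in> analytic_disc" "h \<in> analytic_disc" "g \<in> analytic_disc"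
  shows "integration_op g (\<lambda>z. f z + h z) = (\<lambda>w. integration_op g f w + integration_op g h w)"
proof
  fix w
  show "integration_op g (\<lambda>z. f z + h z) w = integration_op g f w + integration_op g h w"
    using integrand_contour_integrable[OF assms(1,3), of w] integrand_contour_integrable[OF assms(2,3), of w]
    by (simp add: integration_op_def distrib_right contour_integral_add)
qed

lemma integration_op_scale:
  assumes "f \<in> analytic_disc" "g \<in> analytic_disc"
  shows "integration_op g (\<lambda>z. c * f z) = (\<lambda>w. c * integration_op g f w)"
proof
  fix w
  show "integration_op g (\<lambda>z. c * f z) w = c * integration_op g f w"
    using integrand_contour_integrable[OF assms, of w]
    by (simp add: integration_op_def mult.assoc contour_integral_lmul)
qed

text \<open>Continuity for locally uniform convergence: the segment from 0 to \<open>z\<close> stays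
  in \<open>cball 0 R\<close>, where \<open>deriv g\<close> is bounded. The constant is the same for
  all \<open>f\<close>.\<close>

lemma integration_op_bound:
  assumes g: "g \<in> analytic_disc" and "R < 1"
  obtains C where "0 < C" "\<And>f z e. \<lbrakk>f \<in> analytic_disc; cmod z \<le> R; 0 \<le> e; \<And>w. cmod w \<le> R \<Longrightarrow> cmod (f w) \<le> e\<rbrakk>
     \<Longrightarrow> cmod (integration_op g f z) \<le> C * e"
proof -
  have "continuous_on (cball 0 R) (deriv g)"
    using g \<open>R < 1\<close> by (intro continuous_on_subset[OF holomorphic_on_imp_continuous_on
        [OF holomorphic_deriv[OF analytic_disc_holomorphic[OF g] open_ball]]]) auto
  then have "bounded (deriv g ` cball 0 R)"
    by (intro compact_imp_bounded compact_continuous_image) auto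
  then obtain C where C: "0 < C" "\<And>z. cmod z \<le> R \<Longrightarrow> cmod (deriv g z) \<le> C"
    unfolding bounded_pos by auto
  have "cmod (integration_op g f z) \<le> C * e"
    if f: "f \<in> analytic_disc" "cmod z \<le> R" "0 \<le> e" "\<And>w. cmod w \<le> R \<Longrightarrow> cmod (f w) \<le> e" for f z e
  proof -
    have z: "cmod z < 1" using f \<open>R < 1\<close> by simp
    have "cmod (contour_integral (linepath 0 z) (\<lambda>w. f w * deriv g w)) \<le> (e * C) * cmod (z - 0)"
    proof (intro contour_integral_bound_linepath integrand_contour_integrable f g z)
      fix w assume "w \<in> closed_segment 0 z"
      then have "cmod w \<le> R" using segment_in_cball[of z] f(2) by fastforce
      then show "cmod (f w * deriv g w) \<le> e * C"
        unfolding norm_mult using C f by (intro mult_mono) auto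
    qed (use C f in auto)
    also have "\<dots> \<le> (e * C) * 1" using z C f by (intro mult_left_mono) auto
    finally show ?thesis using z by (simp add: integration_op_def mult.commute)
  qed
  then show ?thesis using that C(1) by blast
qed

text \<open>Hardy's inequality asks for a function that vanishes at the left end, hence the
  increment from \<open>rcis a t\<close>. For \<open>a = 0\<close> this is the image itself, which
  gives boundedness; for \<open>a\<close> near 1 it controls tails.\<close>

lemma integration_op_Hardy:
  assumes "1 < p" and g: "g \<in> bloch"
  obtains K where "0 < K" "\<And>f a t. \<lbrakk>f \<in> analytic_disc; 0 \<le> a; a < 1\<rbrakk> \<Longrightarrow>
     (\<integral>\<^sup>+ r\<in>{a..<1}. ennreal (cmod (integration_op g f (rcis r t) - integration_op g f (rcis a t)) powr p) \<partial>lborel)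
     \<le> ennreal K * radint p f a t"
proof -
  obtain B where B: "0 < B" "\<And>z. cmod z < 1 \<Longrightarrow> cmod (deriv g z) \<le> B / (1 - cmod z)"
    using bloch_deriv_bound[OF g] by blast
  note ga = bloch_analytic_disc[OF g]
  define K where "K = 2 * (2 * p) powr p * B powr p"
  have "(\<integral>\<^sup>+ r\<in>{a..<1}. ennreal (cmod (integration_op g f (rcis r t) - integration_op g f (rcis a t)) powr p) \<partial>lborel)
     \<le> ennreal K * radint p f a t" if f: "f \<in> analytic_disc" and a: "0 \<le> a" "a < 1" for f a t
  proof -
    define u where "u r = integration_op g f (rcis r t) - integration_op g f (rcis a t)" for r
    define u' where "u' r = cis t * (f (rcis r t) * deriv g (rcis r t))" for r
    define h where "h r = B * cmod (f (rcis r t))" for r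
    have rc: "((\<lambda>r. rcis r t) has_vector_derivative cis t) (at r)" for r
      unfolding rcis_def by (auto intro!: derivative_eq_intros simp: has_vector_derivative_def scaleR_conv_of_real)
    have "(\<integral>\<^sup>+ r\<in>{a..<1}. ennreal (cmod (u r) powr p) \<partial>lborel)
       \<le> ennreal (2 * (2 * p) powr p) * (\<integral>\<^sup>+ r\<in>{a..<1}. ennreal (h r powr p) \<partial>lborel)"
    proof (rule Hardy_nn_integral[where u'=u'])
      fix r assume r: "r \<in> {a..<1}"
      then have r1: "cmod (rcis r t) = r" "r < 1" using a by auto
      have "(integration_op g f has_field_derivative f (rcis r t) * deriv g (rcis r t)) (at (rcis r t))"
        using r1 by (intro integration_op_deriv f ga) auto
      from field_vector_diff_chain_at[OF rc this]
      show "(u has_vector_derivative u' r) (at r)"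
        unfolding u_def u'_def o_def by (auto intro!: derivative_eq_intros)
      show "cmod (u' r) \<le> h r / (1 - r)"
        using mult_left_mono[OF B(2)[of "rcis r t"] norm_ge_zero[of "f (rcis r t)"]] r1
        by (simp add: u'_def h_def norm_mult mult.commute)
    next
      have "continuous_on {a..<1} (\<lambda>r. f (rcis r t))"
        using a by (intro continuous_on_compose2[OF analytic_disc_continuous[OF f]])
          (auto simp: rcis_def norm_mult intro!: continuous_intros)
      then show "continuous_on {a..<1} h" unfolding h_def by (intro continuous_intros)
    next
      have "(\<lambda>r. integration_op g f (rcis r t)) \<in> borel_measurable borel"
        by (intro radial_measurable integration_op_analytic_disc f ga)
      then show "u \<in> borel_measurable borel" unfolding u_def by measurable
    qed (use assms a in \<open>auto simp: u_def\<close>)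
    also have "(\<integral>\<^sup>+ r\<in>{a..<1}. ennreal (h r powr p) \<partial>lborel) = ennreal (B powr p) * radint p f a t"
    proof -
      note [measurable] = radial_measurable[OF f]
      show ?thesis unfolding radint_def h_def
        using B by (subst nn_integral_cmult[symmetric])
          (auto simp: powr_mult ennreal_mult mult.assoc)
    qed
    also have "ennreal (2 * (2 * p) powr p) * (ennreal (B powr p) * radint p f a t) = ennreal K * radint p f a t"
      by (simp add: K_def ennreal_mult mult.assoc)
    finally show ?thesis by (simp add: u_def)
  qed
  moreover have "0 < K" using B assms by (simp add: K_def)
  ultimately show ?thesis using that by blast
qed

lemma integration_op_radint_le:
  assumes "1 < p" "g \<in> bloch"
  obtains K where "0 < K" "\<And>f t. f \<in> analytic_disc \<Longrightarrow> radint p (integration_op g f) 0 t \<le> ennreal K * radint p f 0 t"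
proof -
  obtain K where K: "0 < K" "\<And>f a t. \<lbrakk>f \<in> analytic_disc; 0 \<le> a; a < 1\<rbrakk> \<Longrightarrow>
     (\<integral>\<^sup>+ r\<in>{a..<1}. ennreal (cmod (integration_op g f (rcis r t) - integration_op g f (rcis a t)) powr p) \<partial>lborel)
     \<le> ennreal K * radint p f a t"
    using integration_op_Hardy[OF assms] by blast
  have "radint p (integration_op g f) 0 t \<le> ennreal K * radint p f 0 t" if "f \<in> analytic_disc" for f t
    using K(2)[OF that, of 0 t] by (simp add: radint_def)
  then show ?thesis using that K(1) by blast
qed

lemma integration_op_RM_inf:
  assumes "1 < p" "g \<in> bloch" "f \<in> RM_inf p"
  shows "integration_op g f \<in> RM_inf p"
proof -
  obtain K where K: "0 < K" "\<And>f t. f \<in> analytic_disc \<Longrightarrow> radint p (integration_op g f) 0 t \<le> ennreal K * radint p f 0 t"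
    using integration_op_radint_le[OF assms(1,2)] by blast
  obtain a where f: "f \<in> analytic_disc" and a: "0 \<le> a" "\<And>t. radint p f 0 t \<le> ennreal a"
    using assms RM_inf_iff[of p f] by auto
  have "radint p (integration_op g f) 0 t \<le> ennreal (K * a)" for t
    using K(2)[OF f, of t] mult_left_mono[OF a(2)[of t], of "ennreal K"] a K
    by (auto simp: ennreal_mult intro: order_trans)
  then show ?thesis using assms a K(1)
    by (subst RM_inf_iff) (auto intro!: exI[of _ "K * a"] integration_op_analytic_disc[OF f bloch_analytic_disc])
qed

lemma integration_op_RM_norm_le:
  assumes "1 < p" "g \<in> bloch"
  obtains C where "\<And>f. f \<in> RM_inf p \<Longrightarrow> RM_norm p (integration_op g f) \<le> C * RM_norm p f"
proof -
  obtain K where K: "0 < K" "\<And>f t. f \<in> analytic_disc \<Longrightarrow> radint p (integration_op g f) 0 t \<le> ennreal K * radint p f 0 t"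
    using integration_op_radint_le[OF assms(1,2)] by blast
  have "RM_norm p (integration_op g f) \<le> K powr (1/p) * RM_norm p f" if f: "f \<in> RM_inf p" for f
  proof -
    have "radint p (integration_op g f) 0 t \<le> ennreal ((K powr (1/p) * RM_norm p f) powr p)" for t
    proof -
      have "radint p (integration_op g f) 0 t \<le> ennreal K * radint p f 0 t"
        using f by (intro K) (auto simp: RM_inf_def)
      also have "\<dots> \<le> ennreal K * ennreal (RM_norm p f powr p)"
        using assms f by (intro mult_left_mono radint_le_RM_norm) auto
      also have "\<dots> = ennreal ((K powr (1/p) * RM_norm p f) powr p)"
        using K(1) assms by (simp add: powr_mult powr_powr RM_norm_nonneg ennreal_mult)
      finally show ?thesis .
    qed
    then show ?thesis
      using RM_norm_le_iff[OF _ integration_op_RM_inf[OF assms f], of "K powr (1/p) * RM_norm p f"] assms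
      by (auto simp: RM_norm_nonneg)
  qed
  then show ?thesis using that by blast
qed

text \<open>Beyond \<open>s\<close> the image is its value at \<open>rcis s t\<close>, bounded
  uniformly in \<open>t\<close>, plus an increment that is controlled by the tail of
  \<open>f\<close>. The constant part becomes small only on a shorter tail, which is why a second
  point \<open>s'\<close> is needed.\<close>

lemma integration_op_RM_zero:
  assumes "1 < p" "g \<in> bloch" "f \<in> RM_zero p"
  shows "integration_op g f \<in> RM_zero p"
proof -
  have p: "0 < p" using assms by simp
  have f: "f \<in> analytic_disc" using assms by (auto simp: RM_zero_def)
  note ga = bloch_analytic_disc[OF assms(2)]
  note Tf = integration_op_analytic_disc[OF f ga]
  obtain K where K: "0 < K" "\<And>f a t. \<lbrakk>f \<in> analytic_disc; 0 \<le> a; a < 1\<rbrakk> \<Longrightarrow>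
     (\<integral>\<^sup>+ r\<in>{a..<1}. ennreal (cmod (integration_op g f (rcis r t) - integration_op g f (rcis a t)) powr p) \<partial>lborel)
     \<le> ennreal K * radint p f a t"
    using integration_op_Hardy[OF assms(1,2)] by blast
  show ?thesis unfolding RM_zero_iff[OF p]
  proof (intro conjI allI impI Tf)
    fix e :: real assume "0 < e"
    define d where "d = e / (2 * 2 powr p)"
    have "0 < d" using \<open>0 < e\<close> by (simp add: d_def)
    then obtain s where s: "0 \<le> s" "s < 1" "\<And>t. radint p f s t \<le> ennreal (d / K)"
      using assms(3) K(1) unfolding RM_zero_iff[OF p] by (metis divide_pos_pos)
    obtain M where M: "0 < M" "\<And>z. cmod z \<le> s \<Longrightarrow> cmod (integration_op g f z) \<le> M"
      using analytic_disc_bounded[OF Tf s(2)] by blast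
    \<comment> \<open>On an interval of length \<open>d / M powr p\<close> a constant of modulus at
      most \<open>M\<close> contributes at most \<open>d\<close>.\<close>
    define s' where "s' = max s (1 - d / M powr p)"
    have s': "s \<le> s'" "s' < 1" "0 \<le> s'" "(1 - s') * M powr p \<le> d"
    proof -
      have "1 - s' \<le> d / M powr p" by (simp add: s'_def)
      then show "(1 - s') * M powr p \<le> d" using M(1) by (simp add: field_simps)
    qed (use s \<open>0 < d\<close> M(1) in \<open>auto simp: s'_def\<close>)
    have "radint p (integration_op g f) s' t \<le> ennreal e" for t
    proof -
      let ?c = "integration_op g f (rcis s t)"
      let ?u = "\<lambda>r. integration_op g f (rcis r t) - ?c"
      have [measurable]: "(\<lambda>r. integration_op g f (rcis r t)) \<in> borel_measurable borel"
        by (rule radial_measurable[OF Tf])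
      have "radint p (integration_op g f) s' t = (\<integral>\<^sup>+ r\<in>{s'..<1}. ennreal (cmod (?c + ?u r) powr p) \<partial>lborel)"
        by (simp add: radint_def)
      also have "\<dots> \<le> ennreal (2 powr p) * ((\<integral>\<^sup>+ r\<in>{s'..<1}. ennreal (cmod ?c powr p) \<partial>lborel) +
         (\<integral>\<^sup>+ r\<in>{s'..<1}. ennreal (cmod (?u r) powr p) \<partial>lborel))"
        using p by (intro nn_integral_add_powr_le) auto
      also have "\<dots> \<le> ennreal (2 powr p) * (ennreal d + ennreal d)"
      proof (intro mult_left_mono add_mono)
        have "cmod ?c powr p \<le> M powr p" using s p by (intro powr_mono2 M) auto
        then have "(\<integral>\<^sup>+ r\<in>{s'..<1}. ennreal (cmod ?c powr p) \<partial>lborel) \<le> ennreal (M powr p * (1 - s'))"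
          using s' by (simp add: nn_integral_cmult_indicator mult_right_mono flip: ennreal_mult)
        also have "\<dots> \<le> ennreal d" using s'(4) by (intro ennreal_leI) (simp add: mult.commute)
        finally show "(\<integral>\<^sup>+ r\<in>{s'..<1}. ennreal (cmod ?c powr p) \<partial>lborel) \<le> ennreal d" .
        have "(\<integral>\<^sup>+ r\<in>{s'..<1}. ennreal (cmod (?u r) powr p) \<partial>lborel)
           \<le> (\<integral>\<^sup>+ r\<in>{s..<1}. ennreal (cmod (?u r) powr p) \<partial>lborel)"
          using s' by (intro nn_integral_mono) (auto simp: indicator_def)
        also have "\<dots> \<le> ennreal K * radint p f s t" using s by (intro K f) auto
        also have "\<dots> \<le> ennreal K * ennreal (d / K)" by (intro mult_left_mono s) auto
        also have "\<dots> = ennreal d" using K \<open>0 < d\<close> by (simp flip: ennreal_mult)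
        finally show "(\<integral>\<^sup>+ r\<in>{s'..<1}. ennreal (cmod (?u r) powr p) \<partial>lborel) \<le> ennreal d" .
      qed auto
      also have "\<dots> = ennreal e" using \<open>0 < d\<close> \<open>0 < e\<close>
        by (simp add: d_def flip: ennreal_plus ennreal_mult)
      finally show ?thesis .
    qed
    then show "\<exists>s\<ge>0. s < 1 \<and> (\<forall>t. radint p (integration_op g f) s t \<le> ennreal e)"
      using s' by (intro exI[of _ s']) auto
  qed
qed

lemma bounded_operator_integration_op:
  assumes "1 < p" "g \<in> bloch" and V: "V = RM_zero p \<or> V = RM_inf p"
  shows "bounded_operator V (RM_norm p) V (RM_norm p) (integration_op g)"
proof -
  have p: "0 < p" using assms by simp
  have sub: "V \<subseteq> RM_inf p" using V RM_zero_subset_RM_inf[OF p] by auto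
  then have V': "x \<in> analytic_disc" if "x \<in> V" for x using that by (auto simp: RM_inf_def)
  obtain C where C: "\<And>f. f \<in> RM_inf p \<Longrightarrow> RM_norm p (integration_op g f) \<le> C * RM_norm p f"
    using integration_op_RM_norm_le[OF assms(1,2)] by blast
  have "integration_op g ` V \<subseteq> V"
    using V integration_op_RM_zero[OF assms(1,2)] integration_op_RM_inf[OF assms(1,2)] by auto
  moreover have "\<forall>x\<in>V. RM_norm p (integration_op g x) \<le> C * RM_norm p x" using C sub by blast
  ultimately show ?thesis unfolding bounded_operator_def clinear_on_def
    by (auto simp: integration_op_add integration_op_scale V' bloch_analytic_disc[OF assms(2)])
qed

section \<open>Point evaluations\<close>

text \<open>Cauchy's integral formula on the circle of radius \<open>r\<close>, whose points keep
  distance at least \<open>r - R\<close> from \<open>z\<close>; the arc length factor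
  \<open>2 * pi * r\<close> is estimated by \<open>2 * pi\<close>.\<close>

lemma cmod_le_circle_mean:
  assumes f: "f \<in> analytic_disc" and z: "cmod z \<le> R" "R < r" "r < 1"
  shows "ennreal (cmod (f z)) \<le>
     ennreal (1 / (r - R)) * (\<integral>\<^sup>+ x\<in>{0..1}. ennreal (cmod (f (rcis r (2 * pi * x)))) \<partial>lborel)"
proof -
  have r0: "0 < r" using z norm_ge_zero[of z] by linarith
  have circ: "circlepath 0 r x = rcis r (2 * pi * x)" for x
    by (simp add: circlepath rcis_def cis_conv_exp mult_ac)
  have vd: "cmod (vector_derivative (circlepath 0 r) (at x)) = 2 * pi * r" for x
    using r0 by (simp add: vector_derivative_circlepath norm_mult)
  define m where "m x = 2 * pi / (r - R) * cmod (f (rcis r (2 * pi * x)))" for x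
  have cm: "continuous_on {0..1} (\<lambda>x. cmod (f (rcis r (2 * pi * x))))"
    using r0 z by (intro continuous_on_norm continuous_on_compose2[OF analytic_disc_continuous[OF f]])
       (auto simp: rcis_def cis_conv_exp norm_mult intro!: continuous_intros)
  have "((\<lambda>u. f u / (u - z)) has_contour_integral (2 * of_real pi * \<i> * f z)) (circlepath 0 r)"
    using z r0 by (intro Cauchy_integral_circlepath continuous_on_subset[OF analytic_disc_continuous[OF f]]
       holomorphic_on_subset[OF analytic_disc_holomorphic[OF f]]) auto
  then have I: "((\<lambda>x. f (circlepath 0 r x) / (circlepath 0 r x - z) * vector_derivative (circlepath 0 r) (at x))
     has_integral (2 * of_real pi * \<i> * f z)) {0..1}"
    by (simp add: has_contour_integral)
  have mi: "m integrable_on {0..1}"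
    unfolding m_def by (intro integrable_continuous_interval continuous_intros cm)
  have "cmod (integral {0..1} (\<lambda>x. f (circlepath 0 r x) / (circlepath 0 r x - z) * vector_derivative (circlepath 0 r) (at x)))
    \<le> integral {0..1} m"
  proof (rule integral_norm_bound_integral[OF has_integral_integrable[OF I] mi])
    fix x :: real
    have "r - R \<le> cmod (circlepath 0 r x - z)"
      using norm_triangle_ineq2[of "circlepath 0 r x" z] r0 z by (simp add: circ)
    then have "cmod (f (circlepath 0 r x)) / cmod (circlepath 0 r x - z) * (2 * pi * r)
       \<le> cmod (f (circlepath 0 r x)) / (r - R) * (2 * pi * 1)"
      using z r0 by (intro mult_mono divide_left_mono mult_pos_pos) auto
    then show "cmod (f (circlepath 0 r x) / (circlepath 0 r x - z) * vector_derivative (circlepath 0 r) (at x)) \<le> m x"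
      by (simp add: norm_mult norm_divide vd m_def circ mult_ac)
  qed
  then have "2 * pi * cmod (f z) \<le> integral {0..1} m"
    using integral_unique[OF I] by (simp add: norm_mult)
  also have "integral {0..1} m = 2 * pi / (r - R) * integral {0..1} (\<lambda>x. cmod (f (rcis r (2 * pi * x))))"
    unfolding m_def by (rule integral_mult_right)
  finally have "(2 * pi) * cmod (f z) \<le> (2 * pi) * (1 / (r - R) * integral {0..1} (\<lambda>x. cmod (f (rcis r (2 * pi * x)))))"
    by simp
  then have "cmod (f z) \<le> 1 / (r - R) * integral {0..1} (\<lambda>x. cmod (f (rcis r (2 * pi * x))))"
    by (rule mult_left_le_imp_le) simp
  then have "ennreal (cmod (f z)) \<le> ennreal (1 / (r - R)) * ennreal (integral {0..1} (\<lambda>x. cmod (f (rcis r (2 * pi * x)))))"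
    using z by (simp flip: ennreal_mult' add: ennreal_leI)
  also have "ennreal (integral {0..1} (\<lambda>x. cmod (f (rcis r (2 * pi * x))))) =
     (\<integral>\<^sup>+ x\<in>{0..1}. ennreal (cmod (f (rcis r (2 * pi * x)))) \<partial>lborel)"
    by (intro nn_integral_has_integral_lebesgue'[symmetric] integrable_integral
         integrable_continuous_interval cm) auto
  finally show ?thesis .
qed

text \<open>The circle estimate is averaged over the radii in \<open>{b..<1}\<close> and the order
  of integration is exchanged. The inner integral then runs along one radius and is at most 2,
  because \<open>y \<le> 1 + y powr p\<close>. With \<open>b\<close> midway between \<open>R\<close>
  and 1, both \<open>b - R\<close> and \<open>1 - b\<close> are \<open>(1 - R) / 2\<close>, which
  gives the constant 8.\<close>

lemma cmod_le_of_radint_le_1: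
  assumes p: "1 \<le> p" and f: "f \<in> analytic_disc" and le: "\<And>t. radint p f 0 t \<le> 1"
    and z: "cmod z \<le> R" "R < 1"
  shows "cmod (f z) \<le> 8 / (1 - R)\<^sup>2"
proof -
  have R0: "0 \<le> R" using z norm_ge_zero[of z] by linarith
  define b where "b = (1 + R) / 2"
  have b: "R < b" "b < 1" "b - R = (1 - R) / 2" "1 - b = (1 - R) / 2" using z by (auto simp: b_def field_simps)
  have [measurable]: "f \<in> borel_measurable borel" by (rule analytic_disc_measurable[OF f])
  define F where "F r x = ennreal (cmod (f (rcis r (2 * pi * x)))) * indicator {0..1} x * indicator {b..<1} r"
    for r x :: real
  have "ennreal (cmod (f z)) * ennreal (1 - b) = (\<integral>\<^sup>+ r. ennreal (cmod (f z)) * indicator {b..<1} r \<partial>lborel)"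
    using b by (subst nn_integral_cmult_indicator) auto
  also have "\<dots> \<le> (\<integral>\<^sup>+ r. ennreal (1 / (b - R)) * (\<integral>\<^sup>+ x. F r x \<partial>lborel) \<partial>lborel)"
  proof (intro nn_integral_mono)
    fix r :: real
    show "ennreal (cmod (f z)) * indicator {b..<1} r \<le> ennreal (1 / (b - R)) * (\<integral>\<^sup>+ x. F r x \<partial>lborel)"
    proof (cases "r \<in> {b..<1}")
      case True
      have "ennreal (cmod (f z)) \<le> ennreal (1 / (r - R)) *
          (\<integral>\<^sup>+ x\<in>{0..1}. ennreal (cmod (f (rcis r (2 * pi * x)))) \<partial>lborel)"
        using True b z by (intro cmod_le_circle_mean f) auto
      also have "\<dots> \<le> ennreal (1 / (b - R)) *
          (\<integral>\<^sup>+ x\<in>{0..1}. ennreal (cmod (f (rcis r (2 * pi * x)))) \<partial>lborel)"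
        using True b by (intro mult_right_mono ennreal_leI divide_left_mono) auto
      finally show ?thesis using True by (simp add: F_def)
    qed auto
  qed
  also have "\<dots> = ennreal (1 / (b - R)) * (\<integral>\<^sup>+ r. \<integral>\<^sup>+ x. F r x \<partial>lborel \<partial>lborel)"
    unfolding F_def by (intro nn_integral_cmult) measurable
  also have "(\<integral>\<^sup>+ r. \<integral>\<^sup>+ x. F r x \<partial>lborel \<partial>lborel) = (\<integral>\<^sup>+ x. \<integral>\<^sup>+ r. F r x \<partial>lborel \<partial>lborel)"
    unfolding F_def by (rule lborel_pair.Fubini'[symmetric]) measurable
  also have "\<dots> \<le> (\<integral>\<^sup>+ x. 2 * indicator {0..1} (x::real) \<partial>lborel)"
  proof (intro nn_integral_mono)
    fix x :: real
    show "(\<integral>\<^sup>+ r. F r x \<partial>lborel) \<le> 2 * indicator {0..1} x"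
    proof (cases "x \<in> {0..1}")
      case True
      have "(\<integral>\<^sup>+ r. F r x \<partial>lborel) \<le> (\<integral>\<^sup>+ r. indicator {0..<1} r +
         ennreal (cmod (f (rcis r (2 * pi * x))) powr p) * indicator {0..<1} r \<partial>lborel)"
      proof (intro nn_integral_mono)
        fix r :: real
        have "y \<le> 1 + y powr p" if "0 \<le> y" for y :: real
          using that p powr_mono[of 1 p y] by (cases "y \<le> 1") (auto simp: powr_ge_zero add_increasing2 add_increasing)
        then have "ennreal (cmod (f (rcis r (2 * pi * x)))) \<le> 1 + ennreal (cmod (f (rcis r (2 * pi * x))) powr p)"
          by (simp flip: ennreal_1 ennreal_plus add: ennreal_leI)
        then show "F r x \<le> indicator {0..<1} r + ennreal (cmod (f (rcis r (2 * pi * x))) powr p) * indicator {0..<1} r"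
          using b R0 True by (auto simp: F_def indicator_def)
      qed
      also have "\<dots> = 1 + radint p f 0 (2 * pi * x)"
        by (simp add: nn_integral_add radint_def)
      also have "\<dots> \<le> 1 + 1" by (intro add_mono le) auto
      finally show ?thesis using True by (simp add: one_add_one)
    qed (auto simp: F_def)
  qed
  also have "\<dots> = 2" by (subst nn_integral_cmult_indicator) auto
  finally have "ennreal (cmod (f z)) * ennreal (1 - b) \<le> ennreal (1 / (b - R)) * 2"
    by (simp add: mult_left_mono)
  also have "\<dots> = ennreal (2 / (b - R))"
    using b by (simp flip: ennreal_numeral ennreal_mult'')
  finally have "ennreal (cmod (f z) * (1 - b)) \<le> ennreal (2 / (b - R))"
    using b(2) by (simp only: ennreal_mult'' less_imp_le diff_ge_0_iff_ge)
  moreover have "0 \<le> 2 / (b - R)" using b(1) by simp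
  ultimately have "cmod (f z) * (1 - b) \<le> 2 / (b - R)"
    by (simp only: ennreal_le_iff)
  then have "cmod (f z) * ((1 - R) * (1 - R)) \<le> 8"
    using z unfolding b by (simp add: field_simps)
  then show ?thesis using z by (subst pos_le_divide_eq) (auto simp: power2_eq_square)
qed

text \<open>Dividing \<open>f\<close> by a number \<open>c\<close> strictly above its norm brings it
  into the unit ball; letting \<open>c\<close> decrease to the norm avoids division by a norm that
  may be 0.\<close>

lemma homogeneous_bound:
  fixes \<phi> :: "(complex \<Rightarrow> complex) \<Rightarrow> complex"
  assumes "0 < p" "0 \<le> C"
    and hom: "\<And>c f. f \<in> RM_inf p \<Longrightarrow> \<phi> (\<lambda>z. c * f z) = c * \<phi> f"
    and le: "\<And>f. f \<in> RM_inf p \<Longrightarrow> (\<And>t. radint p f 0 t \<le> 1) \<Longrightarrow> cmod (\<phi> f) \<le> C"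
    and f: "f \<in> RM_inf p"
  shows "cmod (\<phi> f) \<le> C * RM_norm p f"
proof -
  have *: "cmod (\<phi> f) \<le> C * c" if c: "RM_norm p f < c" for c
  proof -
    have c0: "0 < c" using c RM_norm_nonneg[of p f] by linarith
    have fa: "f \<in> analytic_disc" using f by (simp add: RM_inf_def)
    have "radint p (\<lambda>z. of_real (1 / c) * f z) 0 t \<le> 1" for t
    proof -
      have "radint p (\<lambda>z. of_real (1 / c) * f z) 0 t \<le> ennreal ((1 / c) powr p) * ennreal (c powr p)"
        using c0 radint_le_RM_norm[OF \<open>0 < p\<close> f, of t] c RM_norm_nonneg[of p f] \<open>0 < p\<close>
        unfolding radint_scale[OF fa]
        by (intro mult_mono order_trans[OF radint_le_RM_norm[OF \<open>0 < p\<close> f]] ennreal_leI powr_mono2)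
            (auto simp: norm_divide)
      also have "\<dots> = 1" using c0 by (simp add: powr_divide flip: ennreal_mult)
      finally show ?thesis .
    qed
    then have "cmod (\<phi> (\<lambda>z. of_real (1 / c) * f z)) \<le> C"
      by (intro le RM_inf_scale assms)
    then have "cmod (of_real (1 / c)) * cmod (\<phi> f) \<le> C"
      by (simp only: hom[OF f] norm_mult)
    then show ?thesis using c0 by (simp add: norm_divide field_simps)
  qed
  have "cmod (\<phi> f) \<le> C * RM_norm p f + e" if "0 < e" for e
  proof (cases "C = 0")
    \<comment> \<open>Here \<open>e / C\<close> is 0, so \<open>RM_norm p f + e / C\<close> would
      not exceed the norm.\<close>
    case True
    then show ?thesis using *[of "RM_norm p f + 1"] that by auto
  next
    case False
    then show ?thesis using *[of "RM_norm p f + e / C"] that \<open>0 \<le> C\<close> by (simp add: distrib_left)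
  qed
  then show ?thesis by (rule field_le_epsilon)
qed

lemma evaluation_bound:
  assumes "1 \<le> p" "R < 1" "f \<in> RM_inf p" "cmod z \<le> R"
  shows "cmod (f z) \<le> 8 / (1 - R)\<^sup>2 * RM_norm p f"
  using assms by (intro homogeneous_bound[where \<phi>="\<lambda>f. f z"] cmod_le_of_radint_le_1)
    (auto simp: RM_inf_def)

section \<open>Bounded functionals on locally uniformly null sequences\<close>

text \<open>Unlike the factor \<open>2 powr p\<close> of \<open>add_powr_le\<close>, the factor of
  the first term tends to 1 with \<tau>. The gliding hump adds terms one by one, and a fixed factor
  above 1 would be multiplied at each addition.\<close>

lemma add_powr_perturb:
  fixes x y p \<tau> :: real
  assumes "0 \<le> x" "0 \<le> y" "0 \<le> p" "0 < \<tau>"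
  shows "(x + y) powr p \<le> (1 + \<tau>) powr p * x powr p + (1 + 1 / \<tau>) powr p * y powr p"
proof (cases "y \<le> \<tau> * x")
  case True
  then have "(x + y) powr p \<le> ((1 + \<tau>) * x) powr p"
    using assms by (intro powr_mono2) (auto simp: algebra_simps)
  then show ?thesis using assms by (simp add: powr_mult add_increasing2)
next
  case False
  then have "(x + y) powr p \<le> ((1 + 1 / \<tau>) * y) powr p"
    using assms by (intro powr_mono2) (auto simp: field_simps)
  then show ?thesis using assms by (simp add: powr_mult add_increasing)
qed

text \<open>Below \<open>s\<close> the summand \<open>h\<close> is small, beyond \<open>s\<close>
  the tail of \<open>S\<close> is, so \<open>add_powr_perturb\<close> is used with the roles
  exchanged at \<open>s\<close>. The main terms receive a factor close enough to 1 to cost at most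
  \<open>e / 2\<close>. Since \<eta> depends only on \<open>p\<close>, \<open>B\<close>,
  \<open>M\<close> and \<open>e\<close>, it can be fixed before \<open>s\<close> and
  \<open>h\<close> are chosen.\<close>

lemma radint_add_almost_disjoint:
  assumes p: "0 < p" and "0 \<le> B" "0 \<le> M" "0 < e"
  obtains \<eta> where "0 < \<eta>"
    "\<And>S h s t. \<lbrakk>S \<in> analytic_disc; h \<in> analytic_disc; 0 \<le> s; s \<le> 1; radint p S 0 t \<le> ennreal B; radint p h 0 t \<le> ennreal M;
       radint p S s t \<le> ennreal \<eta>; \<And>z. cmod z \<le> s \<Longrightarrow> cmod (h z) \<le> \<eta> powr (1 / p)\<rbrakk>
     \<Longrightarrow> radint p (\<lambda>z. S z + h z) 0 t \<le> ennreal (B + M + e)"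
proof -
  have "((\<lambda>\<tau>. (1 + \<tau>) powr p * (B + M)) \<longlongrightarrow> (1 + 0) powr p * (B + M)) (at_right 0)"
    by (intro tendsto_intros) auto
  then have "eventually (\<lambda>\<tau>. (1 + \<tau>) powr p * (B + M) < B + M + e / 2) (at_right 0)"
    using \<open>0 < e\<close> by (intro order_tendstoD(2)) auto
  moreover have "eventually (\<lambda>\<tau>::real. 0 < \<tau>) (at_right 0)" by (simp add: eventually_at_right_less)
  ultimately have "eventually (\<lambda>\<tau>. (1 + \<tau>) powr p * (B + M) < B + M + e / 2 \<and> 0 < \<tau>) (at_right 0)"
    by (rule eventually_conj)
  then obtain \<tau> where \<tau>: "(1 + \<tau>) powr p * (B + M) < B + M + e / 2" "0 < \<tau>"
    using eventually_happens trivial_limit_at_right_real by blast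
  define K1 where "K1 = (1 + \<tau>) powr p"
  define K2 where "K2 = (1 + 1 / \<tau>) powr p"
  have "0 < 1 + 1 / \<tau>" using \<tau> by (intro add_pos_pos) auto
  then have K: "0 < K1" "0 < K2" using \<tau> by (auto simp: K1_def K2_def)
  \<comment> \<open>The small terms contribute \<open>K2 * (\<eta> + \<eta>)\<close>, which is then
    \<open>e / 2\<close>.\<close>
  define \<eta> where "\<eta> = e / (4 * K2)"
  have \<eta>: "0 < \<eta>" using K \<open>0 < e\<close> by (simp add: \<eta>_def)
  have "radint p (\<lambda>z. S z + h z) 0 t \<le> ennreal (B + M + e)"
    if S: "S \<in> analytic_disc" "h \<in> analytic_disc" and s: "0 \<le> s" "s \<le> 1"
      and le: "radint p S 0 t \<le> ennreal B" "radint p h 0 t \<le> ennreal M"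
      and small: "radint p S s t \<le> ennreal \<eta>" "\<And>z. cmod z \<le> s \<Longrightarrow> cmod (h z) \<le> \<eta> powr (1 / p)" for S h s t
  proof -
    note [measurable] = radial_measurable[OF S(1)] radial_measurable[OF S(2)]
    let ?S = "\<lambda>r. ennreal (cmod (S (rcis r t)) powr p)"
    let ?h = "\<lambda>r. ennreal (cmod (h (rcis r t)) powr p)"
    have "radint p (\<lambda>z. S z + h z) 0 t \<le> (\<integral>\<^sup>+ r. ennreal K1 * (?S r * indicator {0..<1} r + ?h r * indicator {0..<1} r)
        + ennreal K2 * (?S r * indicator {s..<1} r + ennreal \<eta> * indicator {0..<1} r) \<partial>lborel)"
      unfolding radint_def
    proof (intro nn_integral_mono)
      fix r :: real
      let ?x = "cmod (S (rcis r t))" let ?y = "cmod (h (rcis r t))"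
      have tri: "cmod (S (rcis r t) + h (rcis r t)) powr p \<le> (?x + ?y) powr p"
        using p by (intro powr_mono2 norm_triangle_ineq) auto
      show "ennreal (cmod (S (rcis r t) + h (rcis r t)) powr p) * indicator {0..<1} r \<le>
         ennreal K1 * (?S r * indicator {0..<1} r + ?h r * indicator {0..<1} r)
        + ennreal K2 * (?S r * indicator {s..<1} r + ennreal \<eta> * indicator {0..<1} r)"
      proof (cases "r \<in> {0..<1}")
        case True
        show ?thesis
        proof (cases "r < s")
          case r: True
          have "?y powr p \<le> (\<eta> powr (1 / p)) powr p"
            using r True s p by (intro powr_mono2 small) auto
          then have y: "?y powr p \<le> \<eta>" using p \<eta> by (simp add: powr_powr)
          have "(?x + ?y) powr p \<le> K1 * ?x powr p + K2 * ?y powr p"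
            unfolding K1_def K2_def using p \<tau> by (intro add_powr_perturb) auto
          also have "\<dots> \<le> K1 * (?x powr p + ?y powr p) + K2 * \<eta>"
            using y K by (intro add_mono mult_left_mono) auto
          finally show ?thesis using tri True r s K \<eta>
            by (simp flip: ennreal_mult ennreal_plus add: ennreal_leI)
        next
          case r: False
          have "(?y + ?x) powr p \<le> K1 * ?y powr p + K2 * ?x powr p"
            unfolding K1_def K2_def using p \<tau> by (intro add_powr_perturb) auto
          also have "\<dots> \<le> K1 * (?x powr p + ?y powr p) + K2 * (?x powr p + \<eta>)"
            using K \<eta> by (intro add_mono mult_left_mono) auto
          finally show ?thesis using tri True r s K \<eta>
            by (simp flip: ennreal_mult ennreal_plus add: ennreal_leI add.commute)
        qed
      qed auto
    qed
    also have "\<dots> = ennreal K1 * (radint p S 0 t + radint p h 0 t) + ennreal K2 * (radint p S s t + ennreal \<eta>)"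
      by (simp add: nn_integral_add nn_integral_cmult nn_integral_cmult_indicator radint_def)
    also have "\<dots> \<le> ennreal K1 * (ennreal B + ennreal M) + ennreal K2 * (ennreal \<eta> + ennreal \<eta>)"
      by (intro add_mono mult_left_mono le small) auto
    also have "\<dots> = ennreal (K1 * (B + M) + K2 * (\<eta> + \<eta>))"
      using assms K \<eta> by (simp flip: ennreal_mult ennreal_plus)
    also have "\<dots> \<le> ennreal (B + M + e)"
      using \<tau>(1) K by (intro ennreal_leI) (simp add: K1_def[symmetric] \<eta>_def field_simps)
    finally show ?thesis .
  qed
  then show ?thesis using that \<eta> by blast
qed

lemma zero_RM_zero: "0 < p \<Longrightarrow> (\<lambda>z. 0) \<in> RM_zero p"
  by (auto simp: RM_zero_iff analytic_disc_def radint_def intro!: exI[of _ 0])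

text \<open>A gliding hump: if \<open>\<phi> (h n)\<close> did not tend to 0, then almost disjointly supported \<open>N\<close> terms
  would sum up to an element of norm \<open>O(N powr (1 / p))\<close> on which \<open>\<phi>\<close> grows linearly in \<open>N\<close>.\<close>

lemma bounded_functional_tendsto_0:
  fixes h :: "nat \<Rightarrow> complex \<Rightarrow> complex"
  assumes p: "1 < p" and h: "\<And>n. h n \<in> RM_zero p"
    and bd: "\<And>n t. radint p (h n) 0 t \<le> ennreal M" and "0 \<le> M"
    and lim: "\<And>R. R < 1 \<Longrightarrow> uniform_limit (cball 0 R) h (\<lambda>_. 0) sequentially"
    and \<phi>: "\<phi> \<in> bounded_functionals (RM_zero p) (RM_norm p)"
  shows "(\<lambda>n. \<phi> (h n)) \<longlonglongrightarrow> 0"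
proof (rule ccontr)
  have p0: "0 < p" using p by simp
  have add: "\<phi> (\<lambda>z. x z + y z) = \<phi> x + \<phi> y" if "x \<in> RM_zero p" "y \<in> RM_zero p" for x y
    using \<phi> that by (simp add: bounded_functionals_def)
  have hom: "\<phi> (\<lambda>z. c * x z) = c * \<phi> x" if "x \<in> RM_zero p" for x c
    using \<phi> that by (simp add: bounded_functionals_def)
  obtain C0 where "\<And>x. x \<in> RM_zero p \<Longrightarrow> cmod (\<phi> x) \<le> C0 * RM_norm p x"
    using \<phi> unfolding bounded_functionals_def by blast
  then have C: "cmod (\<phi> x) \<le> \<bar>C0\<bar> * RM_norm p x" if "x \<in> RM_zero p" for x
    using that mult_right_mono[OF abs_ge_self[of C0] RM_norm_nonneg[of p x]] by (meson order_trans)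
  have X: "x \<in> analytic_disc" if "x \<in> RM_zero p" for x using that by (simp add: RM_zero_def)
  assume "\<not> (\<lambda>n. \<phi> (h n)) \<longlonglongrightarrow> 0"
  then obtain \<delta> where \<delta>: "0 < \<delta>" "\<exists>\<^sub>F n in sequentially. \<delta> \<le> cmod (\<phi> (h n))"
    unfolding tendsto_iff by (auto simp: not_eventually not_less)
  \<comment> \<open>Asking for a real value that is at least \<open>real N * \<delta>\<close>
    prevents cancellation between the terms. Each new term costs \<open>M\<close> for itself and 1
    for the failure of exact disjointness.\<close>
  have sums: "\<exists>S\<in>RM_zero p. (\<forall>t. radint p S 0 t \<le> ennreal (real N * (M + 1))) \<and> (\<exists>r. \<phi> S = of_real r \<and> real N * \<delta> \<le> r)" for N
  proof (induction N)
    case 0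
    show ?case
      using zero_RM_zero[OF p0] hom[OF zero_RM_zero[OF p0], of 0] p0
      by (intro bexI[of _ "\<lambda>z. 0"]) (auto simp: radint_def intro!: exI[of _ 0])
  next
    case (Suc N)
    then obtain S r where S: "S \<in> RM_zero p" "\<And>t. radint p S 0 t \<le> ennreal (real N * (M + 1))"
      "\<phi> S = of_real r" "real N * \<delta> \<le> r" by blast
    obtain \<eta> where \<eta>: "0 < \<eta>"
      "\<And>S h s t. \<lbrakk>S \<in> analytic_disc; h \<in> analytic_disc; 0 \<le> s; s \<le> 1; radint p S 0 t \<le> ennreal (real N * (M + 1));
        radint p h 0 t \<le> ennreal M; radint p S s t \<le> ennreal \<eta>; \<And>z. cmod z \<le> s \<Longrightarrow> cmod (h z) \<le> \<eta> powr (1 / p)\<rbrakk>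
       \<Longrightarrow> radint p (\<lambda>z. S z + h z) 0 t \<le> ennreal (real N * (M + 1) + M + 1)"
      using radint_add_almost_disjoint[OF p0, of "real N * (M + 1)" M 1] \<open>0 \<le> M\<close> by auto
    \<comment> \<open>The partial sum lies in the small space and so has a uniformly small tail; the
      next term is then taken far enough along the sequence to be small on
      \<open>cball 0 s\<close>.\<close>
    obtain s where s: "0 \<le> s" "s < 1" "\<And>t. radint p S s t \<le> ennreal \<eta>"
      using S(1) \<eta>(1) unfolding RM_zero_iff[OF p0] by metis
    have "\<forall>\<^sub>F n in sequentially. \<forall>z\<in>cball 0 s. dist (h n z) 0 < \<eta> powr (1 / p)"
      using \<eta>(1) by (intro uniform_limitD[OF lim] s) auto
    from frequently_ex[OF frequently_eventually_frequently[OF \<delta>(2) this]]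
    obtain n where n: "\<delta> \<le> cmod (\<phi> (h n))" "\<And>z. cmod z \<le> s \<Longrightarrow> cmod (h n z) < \<eta> powr (1 / p)"
      by auto
    \<comment> \<open>A unimodular factor that turns \<open>\<phi> (h n)\<close> into its
      modulus.\<close>
    define c where "c = cnj (sgn (\<phi> (h n)))"
    have \<phi>0: "\<phi> (h n) \<noteq> 0" using n(1) \<delta>(1) by auto
    have c1: "cmod c = 1" using \<phi>0 by (simp add: c_def norm_sgn)
    have c2: "c * \<phi> (h n) = of_real (cmod (\<phi> (h n)))"
      using \<phi>0 complex_norm_square[of "\<phi> (h n)"]
      by (simp add: c_def sgn_eq power2_eq_square field_simps)
    define H where "H = (\<lambda>z. c * h n z)"
    have H: "H \<in> RM_zero p" unfolding H_def by (intro RM_zero_scale p0 h)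
    have "radint p (\<lambda>z. S z + H z) 0 t \<le> ennreal (real N * (M + 1) + M + 1)" for t
    proof (rule \<eta>(2)[OF X[OF S(1)] X[OF H] s(1)])
      show "radint p H 0 t \<le> ennreal M"
        using bd[of n t] by (simp add: H_def radint_scale[OF X[OF h]] c1)
      show "cmod (H z) \<le> \<eta> powr (1 / p)" if "cmod z \<le> s" for z
        using n(2)[OF that] by (simp add: H_def norm_mult c1)
    qed (use s S in auto)
    moreover have "\<phi> (\<lambda>z. S z + H z) = of_real (r + cmod (\<phi> (h n)))"
      using add[OF S(1) H] hom[OF h, of c n] by (simp add: S(3) c2 H_def)
    moreover have "real (Suc N) * \<delta> \<le> r + cmod (\<phi> (h n))"
      using S(4) n(1) by (simp add: algebra_simps)
    moreover have "real N * (M + 1) + M + 1 = real (Suc N) * (M + 1)" by (simp add: algebra_simps)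
    ultimately show ?case
      using RM_zero_add[OF p0 S(1) H] by (intro bexI[of _ "\<lambda>z. S z + H z"] conjI exI[of _ "r + cmod (\<phi> (h n))"]) auto
  qed
  have bound: "real N * \<delta> \<le> \<bar>C0\<bar> * (M + 1) powr (1/p) * real N powr (1 / p)" for N
  proof -
    obtain S r where S: "S \<in> RM_zero p" "\<And>t. radint p S 0 t \<le> ennreal (real N * (M + 1))"
      "\<phi> S = of_real r" "real N * \<delta> \<le> r" using sums[of N] by blast
    have "RM_norm p S \<le> (real N * (M + 1)) powr (1 / p)"
      using S(1,2) RM_zero_subset_RM_inf[OF p0] \<open>0 \<le> M\<close> p0
      by (subst RM_norm_le_iff) (auto simp: powr_powr)
    then have "cmod (\<phi> S) \<le> \<bar>C0\<bar> * (real N * (M + 1)) powr (1 / p)"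
      using C[OF S(1)] by (meson abs_ge_zero mult_left_mono order_trans)
    moreover have "real N * \<delta> \<le> cmod (\<phi> S)" using S(3,4) by simp
    ultimately show ?thesis using \<open>0 \<le> M\<close> by (simp add: powr_mult mult_ac)
  qed
  \<comment> \<open>The exponent \<open>1 / p - 1\<close> is negative because \<open>p > 1\<close>;
    this is what contradicts the linear growth.\<close>
  have "(\<lambda>N. \<bar>C0\<bar> * (M + 1) powr (1/p) * real N powr (1 / p - 1)) \<longlonglongrightarrow> \<bar>C0\<bar> * (M + 1) powr (1/p) * 0"
    using p by (intro tendsto_mult tendsto_const tendsto_neg_powr filterlim_real_sequentially) auto
  then have "\<forall>\<^sub>F N in sequentially. \<bar>C0\<bar> * (M + 1) powr (1/p) * real N powr (1 / p - 1) < \<delta>"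
    using \<delta>(1) by (intro order_tendstoD(2)) auto
  from eventually_happens[OF eventually_conj[OF this eventually_gt_at_top[of 0]]]
  obtain N :: nat where N: "\<bar>C0\<bar> * (M + 1) powr (1/p) * real N powr (1 / p - 1) < \<delta>" "0 < N"
    by auto
  have "real N powr (1 / p) = real N powr (1 / p - 1) * real N"
    using N(2) by (simp add: powr_diff)
  then have "\<bar>C0\<bar> * (M + 1) powr (1/p) * real N powr (1 / p) < \<delta> * real N"
    using mult_strict_right_mono[OF N(1), of "real N"] N(2) by (simp add: mult_ac)
  with bound[of N] show False by (simp add: mult.commute)
qed

section \<open>Compactness in the weak topology\<close>

lemma zero_in_bounded_functionals: "(\<lambda>_. 0) \<in> bounded_functionals V N"
  unfolding bounded_functionals_def by simp (rule exI[of _ 0], simp)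

lemma topspace_weak_topology [simp]: "topspace (weak_topology V N) = V"
proof -
  have "{x \<in> V. (0::complex) \<in> UNIV} \<in> {{x \<in> V. \<phi> x \<in> U} |\<phi> U. \<phi> \<in> bounded_functionals V N \<and> open U}"
    using zero_in_bounded_functionals open_UNIV
    by (intro CollectI exI[of _ "\<lambda>_. 0"] exI[of _ UNIV] conjI refl)
  then show ?thesis
    unfolding weak_topology_def topology_generated_by_topspace by auto
qed

lemma openin_weak_topology:
  assumes "\<phi> \<in> bounded_functionals V N" "open U"
  shows "openin (weak_topology V N) {x \<in> V. \<phi> x \<in> U}"
  unfolding weak_topology_def
  by (rule topology_generated_by_Basis, intro CollectI exI[of _ \<phi>] exI[of _ U] conjI refl assms)

text \<open>Functionals restrict to subspaces. Hence weak continuity into \<open>RM_zero p\<close>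
  already yields weak continuity into every larger carrier with the same norm.\<close>

lemma bounded_functionals_antimono:
  assumes "W \<subseteq> V" shows "bounded_functionals V N \<subseteq> bounded_functionals W N"
proof
  fix \<phi> assume "\<phi> \<in> bounded_functionals V N"
  then show "\<phi> \<in> bounded_functionals W N"
    unfolding bounded_functionals_def mem_Collect_eq using assms by (meson subsetD)
qed

lemma evaluation_in_bounded_functionals:
  assumes "1 \<le> p" "V \<subseteq> RM_inf p"
  shows "(\<lambda>f. f z) \<in> bounded_functionals V (RM_norm p)"
proof -
  have "\<exists>C. \<forall>f\<in>V. cmod (f z) \<le> C * RM_norm p f"
  proof (cases "cmod z < 1")
    case True
    then show ?thesis using evaluation_bound[OF assms(1) True] assms(2)
      by (intro exI[of _ "8 / (1 - cmod z)\<^sup>2"]) auto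
  next
    case False
    then have "f z = 0" if "f \<in> V" for f
      using that assms(2) by (auto simp: RM_inf_def analytic_disc_def)
    then show ?thesis by (intro exI[of _ 0]) auto
  qed
  then show ?thesis by (simp add: bounded_functionals_def)
qed

text \<open>Point evaluations are bounded and separate functions. The Hausdorff property makes
  compact sets closed, so that closures can be kept inside a compact image.\<close>

lemma Hausdorff_weak_topology:
  assumes "1 \<le> p" "V \<subseteq> RM_inf p"
  shows "Hausdorff_space (weak_topology V (RM_norm p))"
  unfolding Hausdorff_space_def topspace_weak_topology
proof (intro allI impI, elim conjE)
  fix x y assume xy: "x \<in> V" "y \<in> V" "x \<noteq> y"
  then obtain z where "x z \<noteq> y z" by blast
  then obtain A B where AB: "open A" "open B" "x z \<in> A" "y z \<in> B" "A \<inter> B = {}"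
    using hausdorff[of "x z" "y z"] by blast
  show "\<exists>U W. openin (weak_topology V (RM_norm p)) U \<and> openin (weak_topology V (RM_norm p)) W \<and> x \<in> U \<and> y \<in> W \<and> disjnt U W"
    using openin_weak_topology[OF evaluation_in_bounded_functionals[OF assms, of z] AB(1)]
      openin_weak_topology[OF evaluation_in_bounded_functionals[OF assms, of z] AB(2)] AB xy
    by (intro exI[of _ "{x \<in> V. x z \<in> A}"] exI[of _ "{x \<in> V. x z \<in> B}"]) (auto simp: disjnt_def)
qed

section \<open>Normal families and compactness of the unit ball\<close>

definition RM_ball :: "real \<Rightarrow> (complex \<Rightarrow> complex) set" where
  "RM_ball p = {f \<in> RM_inf p. RM_norm p f \<le> 1}"

lemma RM_ball_iff:
  assumes "0 < p"
  shows "f \<in> RM_ball p \<longleftrightarrow> f \<in> analytic_disc \<and> (\<forall>t. radint p f 0 t \<le> 1)"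
proof (cases "f \<in> RM_inf p")
  case True
  then show ?thesis using RM_norm_le_iff[OF assms True, of 1] by (auto simp: RM_ball_def RM_inf_def)
next
  case False
  then have "\<not> (f \<in> analytic_disc \<and> (\<forall>t. radint p f 0 t \<le> 1))"
    using RM_inf_iff[OF assms, of f] by (metis ennreal_1 zero_le_one)
  then show ?thesis using False by (simp add: RM_ball_def)
qed

text \<open>The pointwise estimate makes the ball locally bounded, so Montel's theorem applies;
  Fatou's lemma along each radius keeps the limit in the ball.\<close>

lemma RM_ball_normal:
  assumes p: "1 \<le> p" and f: "\<And>n. f n \<in> RM_ball p"
  obtains F r where "F \<in> RM_ball p" "strict_mono (r :: nat \<Rightarrow> nat)"
    "\<And>R. R < 1 \<Longrightarrow> uniform_limit (cball (0::complex) R) (f \<circ> r) F sequentially"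
proof -
  have p0: "0 < p" using p by simp
  have bd: "\<exists>B. \<forall>h\<in>RM_ball p. \<forall>z\<in>K. cmod (h z) \<le> B" if K: "compact K" "K \<subseteq> ball 0 1" for K
  proof (cases "K = {}")
    case False
    obtain z0 where z0: "z0 \<in> K" "\<forall>z\<in>K. cmod z \<le> cmod z0"
      using continuous_attains_sup[OF K(1) False, of cmod] by (auto intro: continuous_intros)
    have "cmod z0 < 1" using z0 K by auto
    then show ?thesis
      using cmod_le_of_radint_le_1[OF p] z0 RM_ball_iff[OF p0] by (intro exI[of _ "8 / (1 - cmod z0)\<^sup>2"]) auto
  qed auto
  obtain G r where G: "G holomorphic_on ball 0 1" "strict_mono (r :: nat \<Rightarrow> nat)"
    "\<And>x. x \<in> ball 0 1 \<Longrightarrow> ((\<lambda>n. f (r n) x) \<longlongrightarrow> G x) sequentially"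
    "\<And>K. \<lbrakk>compact K; K \<subseteq> ball 0 1\<rbrakk> \<Longrightarrow> uniform_limit K (f \<circ> r) G sequentially"
  proof (rule Montel[of "ball 0 1" "RM_ball p" f])
    show "h holomorphic_on ball 0 1" if "h \<in> RM_ball p" for h
      using that RM_ball_iff[OF p0] analytic_disc_holomorphic by blast
    show "range f \<subseteq> RM_ball p" using f by blast
    fix G' r' assume "G' holomorphic_on ball 0 1" "strict_mono (r' :: nat \<Rightarrow> nat)"
      "\<And>x. x \<in> ball 0 1 \<Longrightarrow> ((\<lambda>n. f (r' n) x) \<longlongrightarrow> G' x) sequentially"
      "\<And>K. \<lbrakk>compact K; K \<subseteq> ball 0 1\<rbrakk> \<Longrightarrow> uniform_limit K (f \<circ> r') G' sequentially"
    then show thesis by (rule that)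
  qed (use bd in simp_all)
  \<comment> \<open>Montel's theorem says nothing about \<open>G\<close> off the disc; the
    representative in \<open>analytic_disc\<close> vanishes there.\<close>
  define F where "F z = (if z \<in> ball 0 1 then G z else 0)" for z
  have F: "F \<in> analytic_disc"
    using holomorphic_transform[OF G(1), of F] by (simp add: analytic_disc_def F_def)
  have "radint p F 0 t \<le> 1" for t
    unfolding radint_def
  proof (rule nn_integral_powr_le_limit[where F="\<lambda>n x. f (r n) (rcis x t)"])
    show "(\<integral>\<^sup>+ x\<in>{0..<1}. ennreal (cmod (f (r n) (rcis x t)) powr p) \<partial>lborel) \<le> 1" for n
      using f RM_ball_iff[OF p0] unfolding radint_def by blast
    show "(\<lambda>n. f (r n) (rcis x t)) \<longlonglongrightarrow> F (rcis x t)" if "x \<in> {0..<1}" for x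
      using G(3)[of "rcis x t"] that by (simp add: F_def)
    show "(\<lambda>x. f (r n) (rcis x t)) \<in> borel_measurable borel" for n
      using f RM_ball_iff[OF p0] radial_measurable by blast
  qed (use p0 in auto)
  then have "F \<in> RM_ball p" using F RM_ball_iff[OF p0] by blast
  moreover have "uniform_limit (cball (0::complex) R) (f \<circ> r) F sequentially" if "R < 1" for R
  proof -
    have "cball 0 R \<subseteq> ball (0::complex) 1" using that by auto
    then have "uniform_limit (cball (0::complex) R) (f \<circ> r) G sequentially" by (intro G(4)) auto
    then show ?thesis
      by (rule uniform_limit_cong'[THEN iffD1, rotated -1]) (use that in \<open>auto simp: F_def\<close>)
  qed
  ultimately show ?thesis using that G(2) by blast
qed

text \<open>By the identity theorem, sampling along a sequence tending to 0 embeds the unit ball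
  into the metrizable space of complex sequences, with the topology of locally uniform convergence.\<close>

definition sampling :: "(complex \<Rightarrow> complex) \<Rightarrow> nat \<Rightarrow> complex" where
  "sampling f n = f (inverse (of_nat (n + 2)))"

lemma inj_on_sampling: "inj_on sampling analytic_disc"
proof (rule inj_onI)
  fix f g assume f: "f \<in> analytic_disc" and g: "g \<in> analytic_disc" and eq: "sampling f = sampling g"
  let ?U = "range (\<lambda>n. inverse (of_nat (n + 2)) :: complex)"
  have "0 islimpt ?U"
    unfolding islimpt_approachable
  proof (intro allI impI)
    fix e :: real assume "0 < e"
    then obtain n where n: "inverse (real (Suc n)) < e" using reals_Archimedean by blast
    have "inverse (real (n + 2)) \<le> inverse (real (Suc n))" by (intro le_imp_inverse_le) auto
    then have "cmod (inverse (of_nat (n + 2))) < e" using n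
      by (simp only: norm_inverse norm_of_nat)
    moreover have "inverse (of_nat (n + 2)) \<noteq> (0::complex)"
      by (metis add_2_eq_Suc' inverse_eq_iff_eq inverse_zero nat.distinct(1) of_nat_eq_0_iff)
    ultimately show "\<exists>x'\<in>?U. x' \<noteq> 0 \<and> dist x' 0 < e" by (auto simp del: of_nat_add)
  qed
  \<comment> \<open>The offset 2 in \<open>sampling\<close> keeps all sample points inside the open
    disc.\<close>
  moreover have "?U \<subseteq> ball 0 1"
  proof -
    have "cmod (inverse (of_nat (n + 2))) < 1" for n
    proof -
      have "inverse (real (n + 2)) < 1" by (simp add: field_simps)
      then show ?thesis by (simp only: norm_inverse norm_of_nat)
    qed
    then show ?thesis by (auto simp del: of_nat_add)
  qed
  moreover have "(\<lambda>z. f z - g z) holomorphic_on ball 0 1"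
    using f g by (intro holomorphic_intros analytic_disc_holomorphic)
  moreover have "f z - g z = 0" if "z \<in> ?U" for z
    using that fun_cong[OF eq] by (auto simp: sampling_def)
  ultimately have "f z - g z = 0" if "z \<in> ball 0 1" for z
    using that by (intro analytic_continuation[of "\<lambda>z. f z - g z" "ball 0 1" ?U 0 z]) auto
  then show "f = g" using f g by (force simp: analytic_disc_def)
qed

lemma tendsto_fun_componentwise:
  fixes x :: "'a \<Rightarrow> 'b \<Rightarrow> 'c::topological_space"
  assumes "\<And>i. ((\<lambda>n. x n i) \<longlongrightarrow> l i) F"
  shows "(x \<longlongrightarrow> l) F"
  using assms limitin_componentwise[of "\<lambda>_. euclidean" UNIV x l F]
  by (simp add: euclidean_product_topology)

text \<open>Complex sequences form a metric space, so sequential compactness suffices, and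
  \<open>RM_ball_normal\<close> provides it. The set \<open>S\<close> is left general because the
  lemma is needed for the whole ball and for preimages of closed sets.\<close>

lemma compact_sampling:
  assumes p: "1 \<le> p" and S: "S \<subseteq> RM_ball p"
    and closed: "\<And>f F. \<lbrakk>\<And>n. f n \<in> S; F \<in> RM_ball p; \<And>R. R < 1 \<Longrightarrow> uniform_limit (cball (0::complex) R) f F sequentially\<rbrakk> \<Longrightarrow> F \<in> S"
  shows "compact (sampling ` S)"
  unfolding compact_eq_seq_compact_metric seq_compact_def
proof (intro allI impI)
  fix x :: "nat \<Rightarrow> nat \<Rightarrow> complex" assume "\<forall>n. x n \<in> sampling ` S"
  then have "\<forall>n. \<exists>f\<in>S. x n = sampling f" by blast
  then obtain f where f: "\<And>n. f n \<in> S" "\<And>n. x n = sampling (f n)" by metis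
  have fb: "f n \<in> RM_ball p" for n using f(1)[of n] S by blast
  obtain F r where F: "F \<in> RM_ball p" "strict_mono (r :: nat \<Rightarrow> nat)"
    "\<And>R. R < 1 \<Longrightarrow> uniform_limit (cball (0::complex) R) (f \<circ> r) F sequentially"
    using RM_ball_normal[of p f, OF p fb] by blast
  have "(f \<circ> r) n \<in> S" for n using f(1) by simp
  then have "F \<in> S" using F(1,3) by (rule closed)
  have "((x \<circ> r) \<longlongrightarrow> sampling F) sequentially"
  proof (rule tendsto_fun_componentwise)
    fix n
    have "cmod (inverse (of_nat (n + 2))) \<le> 1 / 2"
    proof -
      have "inverse (real (n + 2)) \<le> 1 / 2" by (simp add: field_simps)
      then show ?thesis by (simp only: norm_inverse norm_of_nat)
    qed
    then have "inverse (of_nat (n + 2)) \<in> cball (0::complex) (1 / 2)" by simp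
    moreover have "uniform_limit (cball (0::complex) (1 / 2)) (f \<circ> r) F sequentially"
      by (rule F(3)) simp
    ultimately have "(\<lambda>i. (f \<circ> r) i (inverse (of_nat (n + 2)))) \<longlonglongrightarrow> F (inverse (of_nat (n + 2)))"
      by (intro tendsto_uniform_limitI)
    then show "((\<lambda>i. (x \<circ> r) i n) \<longlongrightarrow> sampling F n) sequentially"
      by (simp only: f(2) sampling_def o_def)
  qed
  then show "\<exists>l\<in>sampling ` S. \<exists>r. strict_mono r \<and> (x \<circ> r) \<longlonglongrightarrow> l"
    using \<open>F \<in> S\<close> F(2) by (intro bexI[of _ "sampling F"] exI[of _ r] conjI) auto
qed

text \<open>By linearity it suffices to treat the images of \<open>f n - F\<close>. They lie in
  \<open>RM_zero p\<close> by \<open>sub\<close>, are bounded, and tend to 0 locally uniformly by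
  \<open>integration_op_bound\<close>, so the gliding hump applies.\<close>

lemma functional_integration_op_tendsto:
  assumes p: "1 < p" and g: "g \<in> bloch" and sub: "integration_op g ` RM_inf p \<subseteq> RM_zero p"
    and \<phi>: "\<phi> \<in> bounded_functionals (RM_zero p) (RM_norm p)"
    and f: "\<And>n. f n \<in> RM_ball p" "F \<in> RM_ball p"
    and lim: "\<And>R. R < 1 \<Longrightarrow> uniform_limit (cball (0::complex) R) f F sequentially"
  shows "(\<lambda>n. \<phi> (integration_op g (f n))) \<longlonglongrightarrow> \<phi> (integration_op g F)"
proof -
  have p0: "0 < p" using p by simp
  note ga = bloch_analytic_disc[OF g]
  have fa: "f n \<in> analytic_disc" "F \<in> analytic_disc" for n using f RM_ball_iff[OF p0] by auto
  define d where "d n = (\<lambda>z. f n z + (-1) * F z)" for n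
  have d: "d n \<in> RM_inf p" for n
    unfolding d_def using f by (intro RM_inf_add RM_inf_scale p0) (auto simp: RM_ball_def)
  then have da: "d n \<in> analytic_disc" for n by (simp add: RM_inf_def)
  obtain K where K: "0 < K" "\<And>f t. f \<in> analytic_disc \<Longrightarrow> radint p (integration_op g f) 0 t \<le> ennreal K * radint p f 0 t"
    using integration_op_radint_le[OF p g] by blast
  have "(\<lambda>n. \<phi> (integration_op g (d n))) \<longlonglongrightarrow> 0"
  proof (rule bounded_functional_tendsto_0[OF p _ _ _ _ \<phi>])
    show "integration_op g (d n) \<in> RM_zero p" for n using sub d by blast
    show "radint p (integration_op g (d n)) 0 t \<le> ennreal (K * (2 powr p * 2))" for n t
    proof -
      have "radint p (d n) 0 t \<le> ennreal (2 powr p) * (radint p (f n) 0 t + radint p (\<lambda>z. (-1) * F z) 0 t)"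
        unfolding d_def using p0 fa by (intro radint_add_le analytic_disc_scale) auto
      also have "\<dots> \<le> ennreal (2 powr p) * (1 + 1)"
        using f RM_ball_iff[OF p0] by (intro mult_left_mono add_mono) (auto simp: radint_scale[OF fa(2), of p "-1", simplified])
      also have "\<dots> = ennreal (2 powr p * 2)" by (simp add: ennreal_mult one_add_one)
      finally have "radint p (integration_op g (d n)) 0 t \<le> ennreal K * ennreal (2 powr p * 2)"
        using K(2)[OF da, of n t] by (meson mult_left_mono order_trans zero_le)
      then show ?thesis using K(1) by (simp add: ennreal_mult)
    qed
    show "0 \<le> K * (2 powr p * 2)" using K(1) by simp
    fix R :: real assume R: "R < 1"
    obtain C where C: "0 < C" "\<And>f z e. \<lbrakk>f \<in> analytic_disc; cmod z \<le> R; 0 \<le> e; \<And>w. cmod w \<le> R \<Longrightarrow> cmod (f w) \<le> e\<rbrakk>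
     \<Longrightarrow> cmod (integration_op g f z) \<le> C * e"
      using integration_op_bound[OF ga R] by blast
    show "uniform_limit (cball (0::complex) R) (\<lambda>n. integration_op g (d n)) (\<lambda>_. 0) sequentially"
    proof (rule uniform_limitI)
      fix e :: real assume "0 < e"
      have "\<forall>\<^sub>F n in sequentially. \<forall>z\<in>cball (0::complex) R. dist (f n z) (F z) < e / (2 * C)"
        using \<open>0 < e\<close> C(1) by (intro uniform_limitD[OF lim] R) auto
      then show "\<forall>\<^sub>F n in sequentially. \<forall>z\<in>cball (0::complex) R. dist (integration_op g (d n) z) 0 < e"
      proof (rule eventually_mono, intro ballI)
        fix n and z :: complex
        assume n: "\<forall>z\<in>cball (0::complex) R. dist (f n z) (F z) < e / (2 * C)" and z: "z \<in> cball 0 R"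
        have "cmod (integration_op g (d n) z) \<le> C * (e / (2 * C))"
          using n z \<open>0 < e\<close> C(1) by (intro C(2) da) (auto simp: d_def dist_norm less_imp_le)
        then show "dist (integration_op g (d n) z) 0 < e" using C(1) \<open>0 < e\<close> by simp
      qed
    qed
  qed
  moreover have "\<phi> (integration_op g (d n)) = \<phi> (integration_op g (f n)) - \<phi> (integration_op g F)" for n
  proof -
    have T: "integration_op g (f n) \<in> RM_zero p" "integration_op g F \<in> RM_zero p"
      using f sub by (auto simp: RM_ball_def)
    have "integration_op g (d n) = (\<lambda>w. integration_op g (f n) w + (-1) * integration_op g F w)"
      unfolding d_def integration_op_add[OF fa(1) analytic_disc_scale[OF fa(2)] ga] integration_op_scale[OF fa(2) ga] ..
    then have "\<phi> (integration_op g (d n)) = \<phi> (integration_op g (f n)) + \<phi> (\<lambda>w. (-1) * integration_op g F w)"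
      using \<phi> T(1) RM_zero_scale[OF p0 T(2), of "-1"] unfolding bounded_functionals_def by (simp only: mem_Collect_eq)
    also have "\<phi> (\<lambda>w. (-1) * integration_op g F w) = (-1) * \<phi> (integration_op g F)"
      using \<phi> T(2) unfolding bounded_functionals_def by blast
    finally show ?thesis by simp
  qed
  ultimately have "(\<lambda>n. \<phi> (integration_op g (f n)) - \<phi> (integration_op g F)) \<longlonglongrightarrow> 0" by simp
  then show ?thesis by (simp add: LIM_zero_iff)
qed

text \<open>The operator factors as \<open>\<psi>\<close> through the compact set of sampled
  functions. For continuity of \<open>\<psi>\<close> only subbasic sets matter: the functions whose
  image violates \<open>\<phi> x \<in> U\<close> form a set closed under locally uniform limits, so
  its samples are compact and therefore closed.\<close>

lemma compactin_integration_op_RM_ball: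
  assumes p: "1 < p" and g: "g \<in> bloch" and sub: "integration_op g ` RM_inf p \<subseteq> RM_zero p"
    and V: "RM_zero p \<subseteq> V" 
  shows "compactin (weak_topology V (RM_norm p)) (integration_op g ` RM_ball p)"
proof -
  have p0: "0 < p" "1 \<le> p" using p by auto
  let ?K = "sampling ` RM_ball p"
  define \<psi> where "\<psi> = integration_op g \<circ> inv_into (RM_ball p) sampling"
  have inj: "inj_on sampling (RM_ball p)"
    by (rule inj_on_subset[OF inj_on_sampling]) (use RM_ball_iff[OF p0(1)] in auto)
  then have \<psi>: "\<psi> (sampling f) = integration_op g f" if "f \<in> RM_ball p" for f
    using that by (simp add: \<psi>_def)
  have TV: "integration_op g f \<in> V" if "f \<in> RM_ball p" for f
    using that sub V by (auto simp: RM_ball_def)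
  have "continuous_map (top_of_set ?K) (weak_topology V (RM_norm p)) \<psi>"
    unfolding weak_topology_def
  proof (rule continuous_on_generated_topo)
    fix W assume "W \<in> {{x \<in> V. \<phi> x \<in> U} |\<phi> U. \<phi> \<in> bounded_functionals V (RM_norm p) \<and> open U}"
    then obtain \<phi> U where W: "W = {x \<in> V. \<phi> x \<in> U}" "\<phi> \<in> bounded_functionals V (RM_norm p)" "open U" by blast
    have \<phi>: "\<phi> \<in> bounded_functionals (RM_zero p) (RM_norm p)"
      using W(2) bounded_functionals_antimono[OF V] by blast
    define S where "S = {f \<in> RM_ball p. \<phi> (integration_op g f) \<notin> U}"
    have "compact (sampling ` S)"
    proof (rule compact_sampling[OF p0(2)])
      fix f F assume f: "\<And>n. f n \<in> S" and F: "F \<in> RM_ball p"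
        "\<And>R. R < 1 \<Longrightarrow> uniform_limit (cball (0::complex) R) f F sequentially"
      have "closed (- U)" using W(3) by auto
      moreover have "\<And>n. \<phi> (integration_op g (f n)) \<in> - U" using f by (auto simp: S_def)
      moreover have "(\<lambda>n. \<phi> (integration_op g (f n))) \<longlonglongrightarrow> \<phi> (integration_op g F)"
        by (rule functional_integration_op_tendsto[OF p g sub \<phi> _ F]) (use f in \<open>auto simp: S_def\<close>)
      ultimately have "\<phi> (integration_op g F) \<in> - U" by (rule closed_sequentially)
      then show "F \<in> S" using F by (simp add: S_def)
    qed (auto simp: S_def)
    then have "open (- sampling ` S)" by (simp add: compact_imp_closed open_closed)
    moreover have "\<psi> -` W \<inter> topspace (top_of_set ?K) = ?K \<inter> (- sampling ` S)"
    proof -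
      have "sampling f \<in> sampling ` S \<longleftrightarrow> f \<in> S" if "f \<in> RM_ball p" for f
        using inj that by (auto simp: S_def inj_on_def)
      then show ?thesis using \<psi> TV by (auto simp: W(1) S_def)
    qed
    ultimately show "openin (top_of_set ?K) (\<psi> -` W \<inter> topspace (top_of_set ?K))"
      by (metis openin_open)
  next
    have "\<psi> ` ?K \<subseteq> V" using \<psi> TV by auto
    then show "\<psi> ` topspace (top_of_set ?K) \<subseteq> \<Union> {{x \<in> V. \<phi> x \<in> U} |\<phi> U. \<phi> \<in> bounded_functionals V (RM_norm p) \<and> open U}"
      using topspace_weak_topology[of V "RM_norm p"]
      unfolding weak_topology_def topology_generated_by_topspace by simp
  qed
  moreover have "compactin (top_of_set ?K) ?K"
    using compact_sampling[OF p0(2) order_refl] by (simp add: compactin_subtopology)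
  ultimately have "compactin (weak_topology V (RM_norm p)) (\<psi> ` ?K)" by (rule image_compactin[rotated])
  moreover have "\<psi> ` ?K = integration_op g ` RM_ball p" using \<psi> by (auto simp: image_iff)
  ultimately show ?thesis by simp
qed

text \<open>The image of the ball of \<open>V\<close> lies in the image of the ball of
  \<open>RM_inf p\<close>, even when \<open>V\<close> is the smaller space. That set is compact,
  hence closed, and so contains the closure.\<close>

lemma weakly_compact_integration_op:
  assumes p: "1 < p" and g: "g \<in> bloch" and sub: "integration_op g ` RM_inf p \<subseteq> RM_zero p"
    and V: "V = RM_zero p \<or> V = RM_inf p"
  shows "weakly_compact_operator V (RM_norm p) V (RM_norm p) (integration_op g)"
proof -
  have p0: "0 < p" "1 \<le> p" using p by auto
  have sV: "RM_zero p \<subseteq> V" "V \<subseteq> RM_inf p" using V RM_zero_subset_RM_inf[OF p0(1)] by auto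
  let ?W = "weak_topology V (RM_norm p)"
  let ?A = "integration_op g ` {x \<in> V. RM_norm p x \<le> 1}"
  have K: "compactin ?W (integration_op g ` RM_ball p)"
    using sV by (intro compactin_integration_op_RM_ball p g sub)
  have "?A \<subseteq> integration_op g ` RM_ball p" using sV by (auto simp: RM_ball_def)
  then have "?W closure_of ?A \<subseteq> integration_op g ` RM_ball p"
    by (rule closure_of_minimal) (intro compactin_imp_closedin Hausdorff_weak_topology K sV p0)
  then have "compactin ?W (?W closure_of ?A)"
    by (intro closed_compactin[OF K]) auto
  then show ?thesis
    using bounded_operator_integration_op[OF p g V] by (simp add: weakly_compact_operator_def)
qed

section \<open>Dilations and weak cluster points\<close>

text \<open>Otherwise finitely many open sets, each eventually avoided by the sequence, would cover
  \<open>K\<close>.\<close>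

lemma compactin_cluster_point:
  fixes y :: "nat \<Rightarrow> 'a"
  assumes "compactin X K" and y: "\<And>n. y n \<in> K"
  obtains h where "h \<in> K" "\<And>U. openin X U \<Longrightarrow> h \<in> U \<Longrightarrow> \<exists>\<^sub>F n in sequentially. y n \<in> U"
proof -
  have "\<exists>h\<in>K. \<forall>U. openin X U \<and> h \<in> U \<longrightarrow> (\<exists>\<^sub>F n in sequentially. y n \<in> U)"
  proof (rule ccontr)
    assume "\<not> ?thesis"
    then have "\<forall>h\<in>K. \<exists>U. openin X U \<and> h \<in> U \<and> (\<forall>\<^sub>F n in sequentially. y n \<notin> U)"
      by (simp add: not_frequently)
    then obtain U where U: "\<And>h. h \<in> K \<Longrightarrow> openin X (U h)" "\<And>h. h \<in> K \<Longrightarrow> h \<in> U h"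
      "\<And>h. h \<in> K \<Longrightarrow> \<forall>\<^sub>F n in sequentially. y n \<notin> U h" by metis
    have "\<exists>\<F>. finite \<F> \<and> \<F> \<subseteq> U ` K \<and> K \<subseteq> \<Union> \<F>"
      using \<open>compactin X K\<close> U(1,2) unfolding compactin_def by (metis (no_types, lifting) UN_iff imageE subsetI)
    then obtain \<F> where \<F>: "finite \<F>" "\<F> \<subseteq> U ` K" "K \<subseteq> \<Union> \<F>" by blast
    have "\<forall>\<^sub>F n in sequentially. \<forall>A\<in>\<F>. y n \<notin> A"
      using \<F>(1,2) U(3) by (subst eventually_ball_finite_distrib) auto
    from eventually_happens[OF this] obtain n where "\<forall>A\<in>\<F>. y n \<notin> A" by auto
    with y[of n] \<F>(3) show False by blast
  qed
  then show ?thesis using that by blast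
qed

definition dilation :: "real \<Rightarrow> (complex \<Rightarrow> complex) \<Rightarrow> complex \<Rightarrow> complex" where
  "dilation r f z = (if z \<in> ball 0 1 then f (of_real r * z) else 0)"

lemma dilation_analytic_disc:
  assumes "f \<in> analytic_disc" "0 < r" "r < 1"
  shows "dilation r f \<in> analytic_disc"
proof -
  have "(\<lambda>z. of_real r * z) ` ball 0 1 \<subseteq> ball (0::complex) 1"
  proof -
    have "r * cmod z < 1" if "cmod z < 1" for z :: complex
      using that assms mult_left_le_one_le[of "cmod z" r] by simp
    then show ?thesis using assms by (auto simp: norm_mult)
  qed
  then have "(f \<circ> (\<lambda>z. of_real r * z)) holomorphic_on ball 0 1"
    by (intro holomorphic_on_compose holomorphic_intros
        holomorphic_on_subset[OF analytic_disc_holomorphic[OF assms(1)]])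
  then have "dilation r f holomorphic_on ball 0 1"
    by (rule holomorphic_transform) (simp add: dilation_def)
  then show ?thesis by (simp add: analytic_disc_def dilation_def)
qed

text \<open>A dilation is bounded by some \<open>M\<close> on the disc, so its tails are at most
  \<open>M powr p * (1 - s)\<close>.\<close>

lemma dilation_RM_zero:
  assumes "0 < p" "f \<in> analytic_disc" "0 < r" "r < 1"
  shows "dilation r f \<in> RM_zero p"
proof -
  obtain M where M: "0 < M" "\<And>z. cmod z \<le> r \<Longrightarrow> cmod (f z) \<le> M"
    using analytic_disc_bounded[OF assms(2,4)] by blast
  have bd: "cmod (dilation r f z) \<le> M" for z
    using M assms by (auto simp: dilation_def norm_mult mult_left_le intro!: M(2))
  show ?thesis unfolding RM_zero_iff[OF assms(1)]
  proof (intro conjI allI impI dilation_analytic_disc assms)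
    fix e :: real assume "0 < e"
    define s where "s = max 0 (1 - e / M powr p)"
    have s: "0 \<le> s" "s < 1" using \<open>0 < e\<close> M(1) by (auto simp: s_def)
    have se: "M powr p * (1 - s) \<le> e"
    proof -
      have "1 - s \<le> e / M powr p" by (simp add: s_def)
      then show ?thesis using M(1) by (simp add: field_simps)
    qed
    have "radint p (dilation r f) s t \<le> ennreal e" for t
    proof -
      have "radint p (dilation r f) s t \<le> (\<integral>\<^sup>+ x. ennreal (M powr p) * indicator {s..<1} x \<partial>lborel)"
        unfolding radint_def using assms(1)
        by (intro nn_integral_mono mult_right_mono ennreal_leI powr_mono2 bd) auto
      also have "\<dots> = ennreal (M powr p * (1 - s))"
        using s by (simp add: nn_integral_cmult_indicator ennreal_mult)
      also have "\<dots> \<le> ennreal e" using se by (intro ennreal_leI)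
      finally show ?thesis .
    qed
    then show "\<exists>s\<ge>0. s < 1 \<and> (\<forall>t. radint p (dilation r f) s t \<le> ennreal e)"
      using s by (intro exI[of _ s]) simp
  qed
qed

text \<open>Substitution along the radius, with Jacobian \<open>r\<close>; equality fails because
  the dilation sees only the radii below \<open>r\<close>.\<close>

lemma radint_dilation_le:
  assumes f: "f \<in> analytic_disc" and r: "0 < r" "r < 1"
  shows "ennreal r * radint p (dilation r f) 0 t \<le> radint p f 0 t"
proof -
  note [measurable] = radial_measurable[OF f] radial_measurable[OF dilation_analytic_disc[OF f r]]
  have "radint p f 0 t = ennreal r * (\<integral>\<^sup>+ x. ennreal (cmod (f (rcis (r * x) t)) powr p) * indicator {0..<1} (r * x) \<partial>lborel)"
    unfolding radint_def using nn_integral_real_affine[of "\<lambda>x. ennreal (cmod (f (rcis x t)) powr p) * indicator {0..<1} x" r 0] r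
    by simp
  moreover have "radint p (dilation r f) 0 t \<le> (\<integral>\<^sup>+ x. ennreal (cmod (f (rcis (r * x) t)) powr p) * indicator {0..<1} (r * x) \<partial>lborel)"
    unfolding radint_def
  proof (intro nn_integral_mono)
    fix x :: real
    have "of_real r * rcis x t = rcis (r * x) t" by (simp add: rcis_def)
    moreover have "0 \<le> r * x \<and> r * x < 1" if "0 \<le> x" "x < 1"
      using that r by (auto intro: le_less_trans[OF mult_left_le_one_le])
    ultimately show "ennreal (cmod (dilation r f (rcis x t)) powr p) * indicator {0..<1} x
       \<le> ennreal (cmod (f (rcis (r * x) t)) powr p) * indicator {0..<1} (r * x)"
      by (auto simp: indicator_def dilation_def)
  qed
  ultimately show ?thesis by (simp add: mult_left_mono)
qed

text \<open>The bound 1/2 on \<open>f\<close> pays for the factor \<open>1 / r \<le> 2\<close> from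
  the substitution. This is the origin of the normalization by 1/2 in the lemmas that
  follow.\<close>

lemma dilation_in_RM_ball:
  assumes "0 < p" "f \<in> analytic_disc" and le: "\<And>t. radint p f 0 t \<le> ennreal (1 / 2)" and r: "1 / 2 \<le> r" "r < 1"
  shows "dilation r f \<in> RM_ball p"
  unfolding RM_ball_iff[OF assms(1)]
proof (intro conjI allI dilation_analytic_disc assms)
  fix t
  have "ennreal (1 / 2) * radint p (dilation r f) 0 t \<le> ennreal r * radint p (dilation r f) 0 t"
    using r by (intro mult_right_mono ennreal_leI) auto
  also have "\<dots> \<le> ennreal (1 / 2)"
    using radint_dilation_le[OF assms(2), of r p t] le[of t] r by (auto intro: order_trans)
  finally have "ennreal 2 * (ennreal (1 / 2) * radint p (dilation r f) 0 t) \<le> ennreal 2 * ennreal (1 / 2)"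
    by (rule mult_left_mono) simp
  moreover have "ennreal 2 * ennreal (1 / 2) = ennreal (2 * (1 / 2))"
    by (rule ennreal_mult[symmetric]) auto
  then have "ennreal 2 * ennreal (1 / 2) = 1" by simp
  ultimately show "radint p (dilation r f) 0 t \<le> 1"
    by (metis mult.assoc mult_1)
qed (use r in auto)

text \<open>Uniform continuity of \<open>f\<close> on \<open>cball 0 R\<close> makes the dilations
  converge uniformly there, and \<open>integration_op_bound\<close> carries this over to the
  images.\<close>

lemma integration_op_dilation_tendsto:
  assumes f: "f \<in> analytic_disc" and g: "g \<in> analytic_disc" and z: "cmod z < 1"
    and r: "\<And>n. 0 < r n" "\<And>n. r n < 1" "r \<longlonglongrightarrow> 1"
  shows "(\<lambda>n. integration_op g (dilation (r n) f) z) \<longlonglongrightarrow> integration_op g f z"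
proof -
  define R where "R = cmod z"
  have R: "R < 1" using z by (simp add: R_def)
  obtain C where C: "0 < C" "\<And>f z e. \<lbrakk>f \<in> analytic_disc; cmod z \<le> R; 0 \<le> e; \<And>w. cmod w \<le> R \<Longrightarrow> cmod (f w) \<le> e\<rbrakk>
     \<Longrightarrow> cmod (integration_op g f z) \<le> C * e"
    using integration_op_bound[OF g R] by blast
  have "uniformly_continuous_on (cball 0 R) f"
    using R by (intro compact_uniformly_continuous continuous_on_subset[OF analytic_disc_continuous[OF f]]) auto
  show ?thesis
  proof (rule tendstoI)
    fix e :: real assume e: "0 < e"
    then have "0 < e / (2 * C)" using C(1) by simp
    then obtain d where d: "0 < d"
      "\<And>w w'. \<lbrakk>w \<in> cball 0 R; w' \<in> cball 0 R; dist w' w < d\<rbrakk> \<Longrightarrow> dist (f w') (f w) < e / (2 * C)"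
      using \<open>uniformly_continuous_on (cball 0 R) f\<close> unfolding uniformly_continuous_on_def by meson
    have "\<forall>\<^sub>F n in sequentially. dist (r n) 1 < d" using r(3) d(1) by (rule tendstoD)
    then show "\<forall>\<^sub>F n in sequentially. dist (integration_op g (dilation (r n) f) z) (integration_op g f z) < e"
    proof (rule eventually_mono)
      fix n assume n: "dist (r n) 1 < d"
      let ?D = "dilation (r n) f"
      have D: "?D \<in> analytic_disc" by (intro dilation_analytic_disc f r)
      have "cmod (integration_op g (\<lambda>z. ?D z + (-1) * f z) z) \<le> C * (e / (2 * C))"
      proof (rule C(2))
        show "(\<lambda>z. ?D z + (-1) * f z) \<in> analytic_disc"
          by (intro analytic_disc_add analytic_disc_scale D f)
        fix w :: complex assume w: "cmod w \<le> R"
        have 1: "cmod (of_real (r n) * w) \<le> R"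
          using w r(1)[of n] r(2)[of n] by (simp add: norm_mult) (meson less_imp_le mult_left_le_one_le norm_ge_zero order_trans)
        have "dist (of_real (r n) * w) w = dist (r n) 1 * cmod w"
        proof -
          have "of_real (r n) * w - w = of_real (r n - 1) * w" by (simp add: algebra_simps)
          then show ?thesis by (simp only: dist_norm norm_mult norm_of_real real_norm_def)
        qed
        also have "\<dots> \<le> dist (r n) 1 * 1" using w R by (intro mult_left_mono) auto
        finally have "dist (f (of_real (r n) * w)) (f w) < e / (2 * C)" using 1 w n by (intro d) auto
        then show "cmod (?D w + (-1) * f w) \<le> e / (2 * C)"
          using w R by (simp add: dilation_def dist_norm)
      qed (use C(1) e in \<open>auto simp: R_def\<close>)
      moreover have "integration_op g (\<lambda>z. ?D z + (-1) * f z) z = integration_op g ?D z - integration_op g f z"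
        using integration_op_add[OF D analytic_disc_scale[OF f, of "-1"] g] integration_op_scale[OF f g, of "-1"] by simp
      ultimately show "dist (integration_op g ?D z) (integration_op g f z) < e"
        using C(1) e by (simp add: dist_norm)
    qed
  qed
qed

text \<open>A general \<open>V\<close> between the two spaces serves both cases: for
  \<open>V = RM_zero p\<close> the content is in the first conclusion, for
  \<open>V = RM_inf p\<close> in the second.\<close>

lemma weakly_compact_imp_limit:
  assumes p: "1 < p" and g: "g \<in> bloch" and V: "RM_zero p \<subseteq> V" "V \<subseteq> RM_inf p"
    and wc: "weakly_compact_operator V (RM_norm p) V (RM_norm p) (integration_op g)"
    and f: "f \<in> analytic_disc" "\<And>t. radint p f 0 t \<le> ennreal (1 / 2)"
  shows "integration_op g f \<in> V"
    and "\<lbrakk>\<phi> \<in> bounded_functionals V (RM_norm p); \<And>x. x \<in> RM_zero p \<Longrightarrow> \<phi> x = 0\<rbrakk> \<Longrightarrow> \<phi> (integration_op g f) = 0"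
proof -
  have p0: "0 < p" "1 \<le> p" using p by auto
  note ga = bloch_analytic_disc[OF g]
  \<comment> \<open>The offset 2 makes \<open>r n\<close> at least 1/2, as
    \<open>dilation_in_RM_ball\<close> requires.\<close>
  define r where "r n = 1 - 1 / (real n + 2)" for n
  have r: "1 / 2 \<le> r n" "0 < r n" "r n < 1" for n
    by (auto simp: r_def field_simps)
  have rlim: "r \<longlonglongrightarrow> 1" unfolding r_def by real_asymp
  define y where "y n = integration_op g (dilation (r n) f)" for n
  have D0: "dilation (r n) f \<in> RM_zero p" for n by (intro dilation_RM_zero p0 f r)
  have y0: "y n \<in> RM_zero p" for n unfolding y_def by (intro integration_op_RM_zero p g D0)
  let ?W = "weak_topology V (RM_norm p)"
  let ?A = "integration_op g ` {x \<in> V. RM_norm p x \<le> 1}"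
  have "?A \<subseteq> V" using wc unfolding weakly_compact_operator_def bounded_operator_def by blast
  then have "?A \<subseteq> ?W closure_of ?A" by (intro closure_of_subset) simp
  moreover have "y n \<in> ?A" for n
  proof -
    have "dilation (r n) f \<in> RM_ball p" by (intro dilation_in_RM_ball p0 f r)
    then show ?thesis using D0[of n] V unfolding y_def RM_ball_def by blast
  qed
  ultimately have yK: "y n \<in> ?W closure_of ?A" for n by blast
  have cW: "compactin ?W (?W closure_of ?A)" using wc by (simp add: weakly_compact_operator_def)
  obtain h where h: "h \<in> ?W closure_of ?A" "\<And>U. openin ?W U \<Longrightarrow> h \<in> U \<Longrightarrow> \<exists>\<^sub>F n in sequentially. y n \<in> U"
    using compactin_cluster_point[of ?W "?W closure_of ?A" y, OF cW yK] by blast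
  have hV: "h \<in> V" using h(1) closure_of_subset_topspace[of ?W ?A] by auto
  have "h z = integration_op g f z" for z
  proof (cases "cmod z < 1")
    case True
    show ?thesis
    proof (rule ccontr)
      assume ne: "h z \<noteq> integration_op g f z"
      then obtain A B where AB: "open A" "open B" "h z \<in> A" "integration_op g f z \<in> B" "A \<inter> B = {}"
        using hausdorff[of "h z" "integration_op g f z"] by blast
      have "\<exists>\<^sub>F n in sequentially. y n \<in> {x \<in> V. x z \<in> A}"
        using hV AB by (intro h openin_weak_topology evaluation_in_bounded_functionals p0 V) auto
      \<comment> \<open>The cluster point controls infinitely many terms, the limit of the
        evaluations all but finitely many; some term would lie in both disjoint sets.\<close>
      moreover have "\<forall>\<^sub>F n in sequentially. y n z \<in> B"
        unfolding y_def using integration_op_dilation_tendsto[OF f(1) ga True r(2,3) rlim] AB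
        by (intro topological_tendstoD) auto
      ultimately have "\<exists>\<^sub>F n in sequentially. y n \<in> {x \<in> V. x z \<in> A} \<and> y n z \<in> B"
        by (rule frequently_eventually_frequently)
      then show False using AB(5) frequently_ex by fastforce
    qed
  next
    case False
    then show ?thesis using hV V by (auto simp: RM_inf_def analytic_disc_def integration_op_def)
  qed
  then have hT: "h = integration_op g f" by blast
  show "integration_op g f \<in> V" using hT hV by simp
  show "\<phi> (integration_op g f) = 0"
    if \<phi>: "\<phi> \<in> bounded_functionals V (RM_norm p)" "\<And>x. x \<in> RM_zero p \<Longrightarrow> \<phi> x = 0"
  proof (rule ccontr)
    assume ne: "\<phi> (integration_op g f) \<noteq> 0"
    have "\<exists>\<^sub>F n in sequentially. y n \<in> {x \<in> V. \<phi> x \<in> - {0}}"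
      using ne hV hT by (intro h openin_weak_topology \<phi>) auto
    then show False using \<phi>(2)[OF y0] frequently_ex by fastforce
  qed
qed

section \<open>Functionals vanishing on RM(p,0)\<close>

text \<open>Integration of \<open>h\<close> over a tail of one radius against the norming function
  of \<open>u\<close>: up to normalization, \<open>cnj (sgn u) * (cmod u) powr (p - 1)\<close> is
  the element of the dual Lebesgue space at which \<open>u\<close> attains its norm.\<close>

definition dual_pairing :: "real \<Rightarrow> (complex \<Rightarrow> complex) \<Rightarrow> real \<Rightarrow> real \<Rightarrow> (complex \<Rightarrow> complex) \<Rightarrow> complex" where
  "dual_pairing p u s t h = (LINT r|lborel. indicator {s..<1} r *\<^sub>R
     (h (rcis r t) * (cnj (sgn (u (rcis r t))) * of_real (cmod (u (rcis r t)) powr (p - 1)))))"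

text \<open>Replacing the smaller number by the larger one gives a crude Young inequality, which
  takes the place of Hoelder's inequality for the pairing.\<close>

lemma mult_powr_le_add_powr:
  fixes x y p :: real
  assumes "0 \<le> x" "0 \<le> y" "1 \<le> p"
  shows "x * y powr (p - 1) \<le> x powr p + y powr p"
proof (cases "x \<le> y")
  case True
  have "x * y powr (p - 1) \<le> y * y powr (p - 1)" using True by (intro mult_right_mono) auto
  also have "\<dots> = y powr p" using assms by (cases "y = 0") (auto simp: powr_diff)
  finally show ?thesis by (simp add: add_increasing)
next
  case False
  have "x * y powr (p - 1) \<le> x * x powr (p - 1)"
    using False assms by (intro mult_left_mono powr_mono2) auto
  also have "\<dots> = x powr p" using assms False by (auto simp: powr_diff)
  finally show ?thesis by (simp add: add_increasing2)
qed

text \<open>Both claims follow from the pointwise bound \<open>mult_powr_le_add_powr\<close>. The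
  estimate is not homogeneous in \<open>h\<close>; rescaling \<open>h\<close> repairs this when the
  functional is built.\<close>

lemma
  assumes p: "1 \<le> p" and s: "0 \<le> s" and h: "h \<in> RM_inf p" and u: "u \<in> RM_inf p"
  shows dual_pairing_integrable: "integrable lborel (\<lambda>r. indicator {s..<1} r *\<^sub>R
     (h (rcis r t) * (cnj (sgn (u (rcis r t))) * of_real (cmod (u (rcis r t)) powr (p - 1)))))" (is "integrable _ ?F")
    and dual_pairing_le: "ennreal (cmod (dual_pairing p u s t h)) \<le> radint p h s t + radint p u s t"
proof -
  have p0: "0 < p" using p by simp
  have ha: "h \<in> analytic_disc" "u \<in> analytic_disc" using h u by (auto simp: RM_inf_def)
  note [measurable] = radial_measurable[OF ha(1)] radial_measurable[OF ha(2)]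
  have [measurable]: "cnj \<in> borel_measurable borel" "complex_of_real \<in> borel_measurable borel"
    by (intro borel_measurable_continuous_onI continuous_intros)+
  have meas: "?F \<in> borel_measurable lborel" by measurable
  have "(\<integral>\<^sup>+ r. ennreal (cmod (?F r)) \<partial>lborel) \<le> (\<integral>\<^sup>+ r. ennreal (cmod (h (rcis r t)) powr p) * indicator {s..<1} r
      + ennreal (cmod (u (rcis r t)) powr p) * indicator {s..<1} r \<partial>lborel)"
  proof (intro nn_integral_mono)
    fix r :: real
    let ?x = "cmod (h (rcis r t))" let ?y = "cmod (u (rcis r t))"
    have "cmod (h (rcis r t) * (cnj (sgn (u (rcis r t))) * of_real (?y powr (p - 1)))) \<le> ?x * (1 * ?y powr (p - 1))"
      unfolding norm_mult by (intro mult_mono) (auto simp: norm_sgn)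
    also have "\<dots> \<le> ?x powr p + ?y powr p"
      using mult_powr_le_add_powr[of ?x ?y p] p by simp
    finally show "ennreal (cmod (?F r)) \<le> ennreal (?x powr p) * indicator {s..<1} r + ennreal (?y powr p) * indicator {s..<1} r"
      by (simp add: indicator_def ennreal_leI flip: ennreal_plus)
  qed
  also have "\<dots> = radint p h s t + radint p u s t"
    by (simp add: nn_integral_add radint_def)
  finally have le: "(\<integral>\<^sup>+ r. ennreal (cmod (?F r)) \<partial>lborel) \<le> radint p h s t + radint p u s t" .
  have "radint p h s t < top" "radint p u s t < top"
    using radint_le_RM_norm[OF p0 h, of t] radint_le_RM_norm[OF p0 u, of t] radint_mono[OF s]
    by (meson ennreal_less_top le_less_trans order_trans)+
  then have fin: "(\<integral>\<^sup>+ r. ennreal (cmod (?F r)) \<partial>lborel) < top"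
    using le by (auto intro: le_less_trans)
  show I: "integrable lborel ?F" using fin meas by (intro integrableI_bounded) auto
  show "ennreal (cmod (dual_pairing p u s t h)) \<le> radint p h s t + radint p u s t"
    unfolding dual_pairing_def using integral_norm_bound_ennreal[OF I] le by (rule order_trans)
qed

lemma dual_pairing_add:
  assumes "1 \<le> p" "0 \<le> s" "h \<in> RM_inf p" "k \<in> RM_inf p" "u \<in> RM_inf p"
  shows "dual_pairing p u s t (\<lambda>z. h z + k z) = dual_pairing p u s t h + dual_pairing p u s t k"
  using dual_pairing_integrable[OF assms(1,2,3,5), of t] dual_pairing_integrable[OF assms(1,2,4,5), of t]
  unfolding dual_pairing_def
  by (subst Bochner_Integration.integral_add[symmetric]) (simp_all add: distrib_right scaleR_add_right)

lemma dual_pairing_scale: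
  "dual_pairing p u s t (\<lambda>z. c * h z) = c * dual_pairing p u s t h"
  unfolding dual_pairing_def by (subst integral_mult_right_zero[symmetric]) (simp add: mult_ac)

lemma dual_pairing_self:
  assumes "1 \<le> p" "u \<in> analytic_disc"
  shows "dual_pairing p u s t u = of_real (enn2real (radint p u s t))"
proof -
  note [measurable] = radial_measurable[OF assms(2)]
  have *: "w * (cnj (sgn w) * of_real (cmod w powr (p - 1))) = of_real (cmod w powr p)" for w
  proof (cases "w = 0")
    case False
    have "w * cnj (sgn w) = of_real (cmod w)"
      using False complex_norm_square[of w] by (simp add: sgn_eq power2_eq_square field_simps)
    then have "w * (cnj (sgn w) * of_real (cmod w powr (p - 1))) = of_real (cmod w * cmod w powr (p - 1))"
      by (simp add: mult.assoc[symmetric])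
    also have "cmod w * cmod w powr (p - 1) = cmod w powr p" using False by (simp add: powr_diff)
    finally show ?thesis .
  qed (use assms in simp)
  have "dual_pairing p u s t u = (LINT r|lborel. complex_of_real (indicator {s..<1} r * cmod (u (rcis r t)) powr p))"
    unfolding dual_pairing_def * by (simp add: scaleR_conv_of_real)
  also have "\<dots> = of_real (LINT r|lborel. indicator {s..<1} r * cmod (u (rcis r t)) powr p)"
    by (rule integral_complex_of_real)
  also have "(LINT r|lborel. indicator {s..<1} r * cmod (u (rcis r t)) powr p)
     = enn2real (\<integral>\<^sup>+ r. ennreal (indicator {s..<1} r * cmod (u (rcis r t)) powr p) \<partial>lborel)"
    by (intro integral_eq_nn_integral) auto
  also have "(\<integral>\<^sup>+ r. ennreal (indicator {s..<1} r * cmod (u (rcis r t)) powr p) \<partial>lborel) = radint p u s t"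
    unfolding radint_def by (intro nn_integral_cong) (auto simp: indicator_def)
  finally show ?thesis .
qed

text \<open>The functional is a cluster point, in the product topology, of pairings with the tails of
  \<open>u\<close> on \<open>{s..<1}\<close> as \<open>s\<close> tends to 1.\<close>

lemma singular_functional:
  assumes p: "1 < p" and u: "u \<in> RM_inf p" "u \<notin> RM_zero p"
  obtains \<phi> where "\<phi> \<in> bounded_functionals (RM_inf p) (RM_norm p)"
    "\<And>x. x \<in> RM_zero p \<Longrightarrow> \<phi> x = 0" "\<phi> u \<noteq> 0"
proof -
  have p0: "0 < p" "1 \<le> p" using p by auto
  have ua: "u \<in> analytic_disc" using u by (simp add: RM_inf_def)
  obtain C where C: "0 \<le> C" "\<And>t. radint p u 0 t \<le> ennreal C"
    using u RM_inf_iff[OF p0(1)] by blast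
  obtain e where e: "0 < e" "\<And>s. \<lbrakk>0 \<le> s; s < 1\<rbrakk> \<Longrightarrow> \<exists>t. ennreal e < radint p u s t"
    using u ua unfolding RM_zero_iff[OF p0(1)] by (meson not_le)
  define s where "s n = 1 - 1 / (real n + 1)" for n
  have s: "0 \<le> s n" "s n < 1" for n by (auto simp: s_def)
  have slim: "s \<longlonglongrightarrow> 1" unfolding s_def by real_asymp
  \<comment> \<open>The angle has to vary with the tail: outside \<open>RM_zero p\<close> the tails
    fail to be small uniformly in the angle, not necessarily on one fixed radius.\<close>
  obtain t where t: "\<And>n. ennreal e < radint p u (s n) (t n)" using e(2)[OF s] by metis
  have us: "radint p u (s n) (t n) \<le> ennreal C" for n
    using C(2)[of "t n"] radint_mono[OF s(1)[of n]] by (rule order_trans[rotated])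
  \<comment> \<open>The value 0 off \<open>RM_inf p\<close> puts all these maps into one product of
    discs indexed by arbitrary functions.\<close>
  define \<Phi> where "\<Phi> n h = (if h \<in> RM_inf p then dual_pairing p u (s n) (t n) h else 0)" for n h
  have \<Phi>_add: "\<Phi> n (\<lambda>z. x z + y z) = \<Phi> n x + \<Phi> n y" if "x \<in> RM_inf p" "y \<in> RM_inf p" for n x y
    using that RM_inf_add[OF p0(1) that] by (simp add: \<Phi>_def dual_pairing_add[OF p0(2) s(1) _ _ u(1)])
  have \<Phi>_scale: "\<Phi> n (\<lambda>z. c * x z) = c * \<Phi> n x" if "x \<in> RM_inf p" for n x c
    using that RM_inf_scale[OF p0(1) that] by (simp add: \<Phi>_def dual_pairing_scale)
  have \<Phi>_le: "cmod (\<Phi> n x) \<le> a + C" if "x \<in> RM_inf p" "radint p x (s n) (t n) \<le> ennreal a" "0 \<le> a" for n x a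
  proof -
    have "ennreal (cmod (\<Phi> n x)) \<le> radint p x (s n) (t n) + radint p u (s n) (t n)"
      using dual_pairing_le[OF p0(2) s(1) that(1) u(1)] that(1) by (simp add: \<Phi>_def)
    also have "\<dots> \<le> ennreal a + ennreal C" by (intro add_mono that us)
    finally show ?thesis using that C by (simp flip: ennreal_plus)
  qed
  \<comment> \<open>Compact by Tychonoff's theorem; the radii do not depend on \<open>n\<close>, so
    all pairings belong to it.\<close>
  define K where "K = (\<Pi>\<^sub>E h\<in>UNIV. cball (0::complex) (RM_norm p h powr p + C))"
  have "\<Phi> n \<in> K" for n
  proof -
    have "cmod (\<Phi> n h) \<le> RM_norm p h powr p + C" for h
    proof (cases "h \<in> RM_inf p")
      case True
      then show ?thesis using radint_le_RM_norm[OF p0(1) True, of "t n"] radint_mono[OF s(1)[of n]]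
        by (intro \<Phi>_le) (auto intro: order_trans)
    qed (use C in \<open>simp add: \<Phi>_def\<close>)
    then show ?thesis by (simp add: K_def PiE_UNIV_domain)
  qed
  moreover have "compactin (product_topology (\<lambda>_. euclidean) UNIV) K"
    unfolding K_def compactin_PiE by simp
  then have "compactin euclidean K" by (simp only: euclidean_product_topology)
  ultimately obtain \<phi> where \<phi>: "\<And>U. open U \<Longrightarrow> \<phi> \<in> U \<Longrightarrow> \<exists>\<^sub>F n in sequentially. \<Phi> n \<in> U"
    using compactin_cluster_point[of euclidean K \<Phi>] by (metis open_openin)
  \<comment> \<open>Linearity, boundedness, vanishing on the small space and positivity at
    \<open>u\<close> are all closed conditions on finitely many coordinates and pass to the cluster
    point in this way.\<close>
  have \<phi>_closed: "\<phi> \<in> S" if "closed S" "\<forall>\<^sub>F n in sequentially. \<Phi> n \<in> S" for S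
  proof (rule ccontr)
    assume "\<phi> \<notin> S"
    then have "\<exists>\<^sub>F n in sequentially. \<Phi> n \<in> - S" using that(1) by (intro \<phi>) auto
    then have "\<exists>\<^sub>F n in sequentially. \<Phi> n \<in> - S \<and> \<Phi> n \<in> S"
      using that(2) by (rule frequently_eventually_frequently)
    then show False using frequently_ex by fastforce
  qed
  note cont = continuous_on_product_coordinates
  have add: "\<phi> (\<lambda>z. x z + y z) = \<phi> x + \<phi> y" if "x \<in> RM_inf p" "y \<in> RM_inf p" for x y
    using \<phi>_closed[of "{\<psi>. \<psi> (\<lambda>z. x z + y z) = \<psi> x + \<psi> y}"] \<Phi>_add[OF that]
    by (simp add: closed_Collect_eq continuous_on_add cont)
  have scale: "\<phi> (\<lambda>z. c * x z) = c * \<phi> x" if "x \<in> RM_inf p" for x c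
    using \<phi>_closed[of "{\<psi>. \<psi> (\<lambda>z. c * x z) = c * \<psi> x}"] \<Phi>_scale[OF that]
    by (simp add: closed_Collect_eq continuous_on_mult_left cont)
  have le_closed: "closed {\<psi>. cmod (\<psi> x) \<le> a}" for x :: "complex \<Rightarrow> complex" and a
    by (intro closed_Collect_le continuous_on_norm continuous_on_const cont)
  have bound: "cmod (\<phi> x) \<le> (1 + C) * RM_norm p x" if x: "x \<in> RM_inf p" for x
  proof (rule homogeneous_bound[OF p0(1) _ scale _ x])
    fix f assume f: "f \<in> RM_inf p" "\<And>t. radint p f 0 t \<le> 1"
    have "cmod (\<Phi> n f) \<le> 1 + C" for n
      using f radint_mono[OF s(1)[of n], of p f "t n"] by (intro \<Phi>_le) (auto intro: order_trans)
    then show "cmod (\<phi> f) \<le> 1 + C" using \<phi>_closed[OF le_closed[of f "1 + C"]] by simp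
  qed (use C in auto)
  have zero: "\<phi> x = 0" if x: "x \<in> RM_zero p" for x
  proof -
    have xi: "x \<in> RM_inf p" using x RM_zero_subset_RM_inf[OF p0(1)] by blast
    have xa: "x \<in> analytic_disc" using x by (simp add: RM_zero_def)
    have "cmod (\<phi> x) \<le> 0 + \<epsilon>" if \<epsilon>: "0 < \<epsilon>" for \<epsilon>
    proof -
      \<comment> \<open>A small tail of \<open>x\<close> does not remove \<open>C\<close> from the
        bound \<open>a + C\<close>. Applying that bound to \<open>l * x\<close> and dividing by
        \<open>l\<close> does: \<open>l\<close> is so large that
        \<open>C \<le> l * \<epsilon> / 2\<close>, and the tail of \<open>l * x\<close> supplies the
        other half.\<close>
      define l where "l = 2 * C / \<epsilon> + 1"
      have l: "0 < l" "C \<le> l * \<epsilon> / 2" using C \<epsilon> by (auto simp: l_def add_nonneg_pos field_simps)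
      define a where "a = l * \<epsilon> / 2"
      have a: "0 < a" using l \<epsilon> by (simp add: a_def)
      obtain s0 where s0: "0 \<le> s0" "s0 < 1" "\<And>t. radint p x s0 t \<le> ennreal (a / l powr p)"
        using x a l unfolding RM_zero_iff[OF p0(1)] by (metis divide_pos_pos powr_gt_zero less_irrefl)
      have "\<forall>\<^sub>F n in sequentially. s0 < s n" using slim s0(2) by (rule order_tendstoD)
      then have "\<forall>\<^sub>F n in sequentially. cmod (\<Phi> n x) \<le> \<epsilon>"
      proof (rule eventually_mono)
        fix n assume n: "s0 < s n"
        have "radint p (\<lambda>z. of_real l * x z) (s n) (t n) \<le> ennreal (l powr p) * ennreal (a / l powr p)"
          unfolding radint_scale[OF xa] using l n radint_mono[of s0 "s n" p x "t n"] s0(3)[of "t n"]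
          by (intro mult_mono) (auto intro: order_trans)
        also have "\<dots> = ennreal a" using l a by (simp flip: ennreal_mult)
        finally have "cmod (\<Phi> n (\<lambda>z. of_real l * x z)) \<le> a + C"
          using a by (intro \<Phi>_le RM_inf_scale p0 xi) auto
        then have "l * cmod (\<Phi> n x) \<le> a + C" using l by (simp add: \<Phi>_scale[OF xi] norm_mult)
        also have "\<dots> \<le> l * \<epsilon>" using l(2) by (simp add: a_def)
        finally show "cmod (\<Phi> n x) \<le> \<epsilon>" using l(1) by simp
      qed
      then show ?thesis using \<phi>_closed[OF le_closed[of x \<epsilon>]] by simp
    qed
    then have "cmod (\<phi> x) \<le> 0" by (rule field_le_epsilon)
    then show ?thesis by simp
  qed
  have "e \<le> Re (\<Phi> n u)" for n
  proof -
    have "radint p u (s n) (t n) = ennreal (enn2real (radint p u (s n) (t n)))"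
      using le_less_trans[OF us[of n] ennreal_less_top] by (simp add: ennreal_enn2real)
    then have "ennreal e < ennreal (enn2real (radint p u (s n) (t n)))" using t[of n] by simp
    then have "e \<le> enn2real (radint p u (s n) (t n))" using e(1) by (simp add: ennreal_less_iff)
    then show ?thesis using u(1) by (simp add: \<Phi>_def dual_pairing_self[OF p0(2) ua])
  qed
  moreover have "closed {\<psi>. e \<le> Re (\<psi> u)}"
    by (intro closed_Collect_le continuous_on_Re continuous_on_const cont)
  ultimately have "e \<le> Re (\<phi> u)" using \<phi>_closed[of "{\<psi>. e \<le> Re (\<psi> u)}"] by simp
  then have "\<phi> u \<noteq> 0" using e(1) by auto
  moreover have "\<phi> \<in> bounded_functionals (RM_inf p) (RM_norm p)"
    unfolding bounded_functionals_def using add scale bound by blast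
  ultimately show ?thesis using that zero by blast
qed

text \<open>Homogeneity removes the normalization by 1/2: \<open>f\<close> is multiplied by
  \<open>c\<close> with \<open>c powr p = 1 / (2 * (a + 1))\<close>, where \<open>a + 1\<close> is
  positive even for \<open>a = 0\<close>.\<close>

lemma integration_op_subset_RM_zero:
  assumes p: "1 < p" and g: "g \<in> bloch"
    and *: "\<And>f. f \<in> analytic_disc \<Longrightarrow> (\<And>t. radint p f 0 t \<le> ennreal (1 / 2)) \<Longrightarrow> integration_op g f \<in> RM_zero p"
  shows "integration_op g ` RM_inf p \<subseteq> RM_zero p"
proof (rule image_subsetI)
  fix f assume "f \<in> RM_inf p"
  have p0: "0 < p" using p by simp
  obtain a where f: "f \<in> analytic_disc" and a: "0 \<le> a" "\<And>t. radint p f 0 t \<le> ennreal a"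
    using \<open>f \<in> RM_inf p\<close> RM_inf_iff[OF p0] by blast
  define c where "c = (1 / (2 * (a + 1))) powr (1 / p)"
  have c: "0 < c" "c powr p * a \<le> 1 / 2" using a p0 by (auto simp: c_def powr_powr field_simps)
  have "radint p (\<lambda>z. of_real c * f z) 0 t \<le> ennreal (1 / 2)" for t
  proof -
    have "radint p (\<lambda>z. of_real c * f z) 0 t \<le> ennreal (c powr p) * ennreal a"
      using c a by (simp add: radint_scale[OF f] mult_left_mono)
    also have "\<dots> = ennreal (c powr p * a)" using a by (intro ennreal_mult[symmetric]) auto
    also have "\<dots> \<le> ennreal (1 / 2)" using c(2) by (rule ennreal_leI)
    finally show ?thesis .
  qed
  then have "integration_op g (\<lambda>z. of_real c * f z) \<in> RM_zero p"
    by (intro * analytic_disc_scale f)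
  then have "(\<lambda>w. of_real (1 / c) * integration_op g (\<lambda>z. of_real c * f z) w) \<in> RM_zero p"
    by (rule RM_zero_scale[OF p0])
  then show "integration_op g f \<in> RM_zero p"
    using c(1) by (simp add: integration_op_scale[OF f bloch_analytic_disc[OF g]] mult.assoc[symmetric])
qed

theorem theorem6p2:
  fixes p :: real and g :: "complex \<Rightarrow> complex"
  assumes "1 < p" and "g \<in> bloch"
  shows "(integration_op g ` RM_inf p \<subseteq> RM_zero p \<longleftrightarrow>
           weakly_compact_operator (RM_zero p) (RM_norm p) (RM_zero p) (RM_norm p) (integration_op g))
       \<and> (weakly_compact_operator (RM_zero p) (RM_norm p) (RM_zero p) (RM_norm p) (integration_op g) \<longleftrightarrow>
           weakly_compact_operator (RM_inf p) (RM_norm p) (RM_inf p) (RM_norm p) (integration_op g))"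
    (is "(?sub \<longleftrightarrow> ?wcX) \<and> (?wcX \<longleftrightarrow> ?wcY)")
proof -
  have p0: "0 < p" using assms(1) by simp
  note XY = RM_zero_subset_RM_inf[OF p0]
  have "?sub \<Longrightarrow> ?wcX" "?sub \<Longrightarrow> ?wcY"
    using weakly_compact_integration_op[OF assms] by blast+
  moreover have "?wcX \<Longrightarrow> ?sub"
    by (rule integration_op_subset_RM_zero[OF assms])
      (rule weakly_compact_imp_limit(1)[OF assms order_refl XY])
  moreover have "?sub" if wc: "?wcY"
  proof (rule integration_op_subset_RM_zero[OF assms])
    fix f assume f: "f \<in> analytic_disc" "\<And>t. radint p f 0 t \<le> ennreal (1 / 2)"
    note limit = weakly_compact_imp_limit[OF assms XY order_refl wc f]
    show "integration_op g f \<in> RM_zero p"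
      using singular_functional[OF assms(1) limit(1)] limit(2) by metis
  qed
  ultimately show ?thesis by blast
qed

end
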